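(* Let $h:[0,1]^2\to[0,1]$ be a symmetric, measurable function, let $U_1,\dots,U_n$ be independent $U[0,1]$ random variables, and consider the random graph on vertex set $\{1,\dots,n\}$ in which, conditionally on $U_1,\dots,U_n$, edges are independent and the edge between $u\ne v$ is present with probability $\pi_{u,v}=h(U_u,U_v)$. Let $$h^*=\sup_{u,v\in[0,1]}h(u,v).$$ Let $G$ be a fixed strictly balanced graph with $v(G)$ vertices and $e(G)>1$ edges and without isolated vertices, let $W$ be the number of (not necessarily induced) copies of $G$ in this random graph, and let $\lambda=\mathbb{E}W=\binom{n}{v(G)}\rho(G)\mu(G)$, where $$\mu(G)=\int_{[0,1]^{v(G)}}\ \prod_{1\le i<j\le v(G):\,(i,j)\in E(G)}h(u_i,u_j)\ du_1\cdots du_{v(G)}.$$ Then $$d_{TV}(\mathcal{L}(W),Po(\lambda))\le 2(1-e^{-\lambda})\rho(G)\bigg\{2\frac{v(G)^2}{v(G)!}n^{v(G)-1}(h^* )^{e(G)}+h^*+\sum_{s=2}^{v(G)-1}\binom{v(G)}{s}\frac{n^{v(G)-s}(h^* )^{\kappa(G,s)}}{(v(G)-s)!}\bigg\},$$ where $$\kappa(G,s)=\max\big(e(G)-s\,d(G)+\gamma(G),\ (v(G)-s)\,\alpha(G)\big).$$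
   Context: All graphs are finite, undirected, without self-loops or multiple edges. For a graph $H$, $v(H)$ and $e(H)$ denote its numbers of vertices and edges, $V(H)$ and $E(H)$ its vertex and edge sets, and $d(H)=e(H)/v(H)$. The vertex set of the fixed graph $G$ is identified with $\{1,\dots,v(G)\}$. $G$ is strictly balanced if $d(H)<d(G)$ for all (nonempty) subgraphs $H\subsetneq G$. Define $$\rho(G)=\frac{v(G)!}{a(G)},$$ where $a(G)$ is the number of automorphisms of $G$, and $$\alpha(G)=\min_H\frac{e(G)-e(H)}{v(G)-v(H)},\qquad \gamma(G)=\min_H\big(d(G)v(H)-e(H)\big),$$ where both minima are over all nonempty subgraphs $H\subsetneq G$ without isolated vertices (in the definition of $\alpha(G)$, subgraphs with $v(H)=v(G)$ contribute $+\infty$, i.e. are ignored). Copies: let $\Gamma$ be the set of $v(G)$-element subsets of $\{1,\dots,n\}$ (so $|\Gamma|=\binom{n}{v(G)}$). For $\alpha\in\Gamma$ let $R_\alpha(G)$ be the set of all subgraphs of the complete graph on $\alpha$ that are isomorphic to $G$ (so $|R_\alpha(G)|=\rho(G)$). For $G'\in R_\alpha(G)$ let $X_\alpha(G')$ be the indicator that all edges of $G'$ are present in the random graph. Then $W=\sum_{\alpha\in\Gamma}\sum_{G'\in R_\alpha(G)}X_\alpha(G')$. $\mathcal{L}(W)$ is the law of $W$, $Po(\lambda)$ is the Poisson distribution with mean $\lambda$, and for nonnegative integer-valued random variables $d_{TV}(\mathcal{L}(U),\mathcal{L}(V))=\sup_{A\subseteq\mathbb{Z}^+}|\mathbb{P}(U\in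 A)-\mathbb{P}(V\in A)|$, where $\mathbb{Z}^+=\{0,1,2,\dots\}$. *)

theory Defs
  imports "HOL-Probability.Probability"
begin

section \<open>Finite simple graphs\<close>

text \<open>A graph is a pair of a vertex set and a set of edges, each edge being a two-element set.\<close>

type_synonym 'a graph = "'a set \<times> 'a set set"

abbreviation verts :: "'a graph \<Rightarrow> 'a set" where "verts \<equiv> fst"
abbreviation edges :: "'a graph \<Rightarrow> 'a set set" where "edges \<equiv> snd"

definition all_pairs :: "'a set \<Rightarrow> 'a set set" where
  "all_pairs S = {e. e \<subseteq> S \<and> card e = 2}"

definition simple_graph :: "'a graph \<Rightarrow> bool" where
  "simple_graph G \<longleftrightarrow> finite (verts G) \<and> edges G \<subseteq> all_pairs (verts G)"

abbreviation nv :: "'a graph \<Rightarrow> nat" where "nv G \<equiv> card (verts G)"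
abbreviation ne :: "'a graph \<Rightarrow> nat" where "ne G \<equiv> card (edges G)"

definition edge_density :: "'a graph \<Rightarrow> real" where
  "edge_density G = real (ne G) / real (nv G)"

definition complete_graph :: "'a set \<Rightarrow> 'a graph" where
  "complete_graph S = (S, all_pairs S)"

definition subgraph :: "'a graph \<Rightarrow> 'a graph \<Rightarrow> bool" where
  "subgraph H G \<longleftrightarrow> simple_graph H \<and> verts H \<subseteq> verts G \<and> edges H \<subseteq> edges G"

text \<open>Proper subgraphs with at least one vertex; they may be spanning.\<close>

definition proper_subgraphs :: "'a graph \<Rightarrow> 'a graph set" where
  "proper_subgraphs G = {H. subgraph H G \<and> verts H \<noteq> {} \<and> H \<noteq> G}"

definition no_isolated :: "'a graph \<Rightarrow> bool" where
  "no_isolated G \<longleftrightarrow> (\<forall>v\<in>verts G. \<exists>e\<in>edges G. v \<in> e)"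

definition strictly_balanced :: "'a graph \<Rightarrow> bool" where
  "strictly_balanced G \<longleftrightarrow> (\<forall>H\<in>proper_subgraphs G. edge_density H < edge_density G)"

definition isomorphic :: "'a graph \<Rightarrow> 'b graph \<Rightarrow> bool" where
  "isomorphic G H \<longleftrightarrow>
     (\<exists>f. bij_betw f (verts G) (verts H) \<and> (\<lambda>e. f ` e) ` edges G = edges H)"

text \<open>Automorphisms are extended by the identity outside the vertex set, so that each one is
  counted exactly once.\<close>

definition automorphisms :: "'a graph \<Rightarrow> ('a \<Rightarrow> 'a) set" where
  "automorphisms G = {f. f permutes verts G \<and> (\<lambda>e. f ` e) ` edges G = edges G}"

definition rho :: "'a graph \<Rightarrow> real" where
  "rho G = fact (nv G) / real (card (automorphisms G))"

definition alpha :: "'a graph \<Rightarrow> real" where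
  "alpha G = Min {(real (ne G) - real (ne H)) / (real (nv G) - real (nv H)) | H.
     H \<in> proper_subgraphs G \<and> no_isolated H \<and> nv H \<noteq> nv G}"

definition gamma :: "'a graph \<Rightarrow> real" where
  "gamma G = Min {edge_density G * real (nv H) - real (ne H) | H.
     H \<in> proper_subgraphs G \<and> no_isolated H}"

definition kappa :: "'a graph \<Rightarrow> nat \<Rightarrow> real" where
  "kappa G s = max (real (ne G) - real s * edge_density G + gamma G)
                   ((real (nv G) - real s) * alpha G)"

definition copies_on :: "'a graph \<Rightarrow> 'b set \<Rightarrow> 'b graph set" where
  "copies_on G S = {G'. subgraph G' (complete_graph S) \<and> isomorphic G G'}"

text \<open>The number of not necessarily induced copies of \<open>G\<close> in a graph \<open>K\<close> with vertex
  set \<open>{1..n}\<close>.\<close>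

definition num_copies :: "'a graph \<Rightarrow> nat \<Rightarrow> nat graph \<Rightarrow> nat" where
  "num_copies G n K =
     (\<Sum>S\<in>{S. S \<subseteq> {1..n} \<and> card S = nv G}. \<Sum>G'\<in>copies_on G S. of_bool (edges G' \<subseteq> edges K))"

section \<open>The random graph given by a graphon\<close>

definition graphon :: "(real \<Rightarrow> real \<Rightarrow> real) \<Rightarrow> bool" where
  "graphon h \<longleftrightarrow>
     (\<forall>x\<in>{0..1}. \<forall>y\<in>{0..1}. 0 \<le> h x y \<and> h x y \<le> 1 \<and> h x y = h y x) \<and>
     (\<lambda>(x, y). h x y) \<in> borel_measurable (restrict_space borel ({0..1} \<times> {0..1}))"

definition graphon_sup :: "(real \<Rightarrow> real \<Rightarrow> real) \<Rightarrow> real" where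
  "graphon_sup h = (SUP (x, y)\<in>{0..1} \<times> {0..1}. h x y)"

text \<open>Here \<open>G\<close> has vertex set \<open>{1..nv G}\<close>.\<close>

definition mu :: "(real \<Rightarrow> real \<Rightarrow> real) \<Rightarrow> nat graph \<Rightarrow> real" where
  "mu h G = set_lebesgue_integral (\<Pi>\<^sub>M i\<in>{1..nv G}. lborel) (\<Pi>\<^sub>E i\<in>{1..nv G}. {0..1})
     (\<lambda>u. \<Prod>(i, j)\<in>{(i, j). 1 \<le> i \<and> i < j \<and> j \<le> nv G \<and> {i, j} \<in> edges G}. h (u i) (u j))"

definition cond_prob_on :: "'w measure \<Rightarrow> 'w measure \<Rightarrow> 'w set \<Rightarrow> 'w \<Rightarrow> real" where
  "cond_prob_on M F A = real_cond_exp M F (indicator A)"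

text \<open>In the next definition, the intersection with \<open>space M\<close> only matters for \<open>J = {}\<close>.\<close>

definition cond_indep_events ::
    "'w measure \<Rightarrow> 'w measure \<Rightarrow> ('i \<Rightarrow> 'w set) \<Rightarrow> 'i set \<Rightarrow> bool" where
  "cond_indep_events M F A I \<longleftrightarrow>
     (\<forall>J. J \<subseteq> I \<and> finite J \<longrightarrow>
        (AE \<omega> in M. cond_prob_on M F (space M \<inter> (\<Inter>i\<in>J. A i)) \<omega>
                   = (\<Prod>i\<in>J. cond_prob_on M F (A i) \<omega>)))"

definition edge_event :: "'w measure \<Rightarrow> ('w \<Rightarrow> 'a graph) \<Rightarrow> 'a set \<Rightarrow> 'w set" where
  "edge_event M K e = {\<omega> \<in> space M. e \<in> edges (K \<omega>)}"

text \<open>The sigma-algebra generated by \<open>U 1, \<dots>, U n\<close>.\<close>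

definition sigma_of :: "'w measure \<Rightarrow> nat \<Rightarrow> (nat \<Rightarrow> 'w \<Rightarrow> real) \<Rightarrow> 'w measure" where
  "sigma_of M n U =
     vimage_algebra (space M) (\<lambda>\<omega>. \<lambda>i\<in>{1..n}. U i \<omega>) (\<Pi>\<^sub>M i\<in>{1..n}. borel)"

definition graphon_random_graph ::
    "'w measure \<Rightarrow> nat \<Rightarrow> (real \<Rightarrow> real \<Rightarrow> real) \<Rightarrow> (nat \<Rightarrow> 'w \<Rightarrow> real) \<Rightarrow> ('w \<Rightarrow> nat graph) \<Rightarrow> bool"
  where
  "graphon_random_graph M n h U K \<longleftrightarrow>
     prob_space M \<and>
     prob_space.indep_vars M (\<lambda>_. borel) U {1..n} \<and>
     (\<forall>i\<in>{1..n}. distr M borel (U i) = uniform_measure lborel {0..1}) \<and>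
     (\<forall>\<omega>\<in>space M. simple_graph (K \<omega>) \<and> verts (K \<omega>) = {1..n}) \<and>
     (\<forall>e\<in>all_pairs {1..n}. edge_event M K e \<in> sets M) \<and>
     cond_indep_events M (sigma_of M n U) (edge_event M K) (all_pairs {1..n}) \<and>
     (\<forall>u\<in>{1..n}. \<forall>v\<in>{1..n}. u \<noteq> v \<longrightarrow>
        (AE \<omega> in M. cond_prob_on M (sigma_of M n U) (edge_event M K {u, v}) \<omega>
                   = h (U u \<omega>) (U v \<omega>)))"

section \<open>Laws and total variation distance\<close>

definition law :: "'w measure \<Rightarrow> ('w \<Rightarrow> nat) \<Rightarrow> nat measure" where
  "law M W = distr M (count_space UNIV) W"

definition d_TV :: "nat measure \<Rightarrow> nat measure \<Rightarrow> real" where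
  "d_TV P Q = (SUP A. \<bar>measure P A - measure Q A\<bar>)"

text \<open>The library specifies \<^const>\<open>poisson_pmf\<close> for positive rates only, whereas the
  mean number of copies may vanish.\<close>

definition Po :: "real \<Rightarrow> nat pmf" where
  "Po rate = (if rate = 0 then return_pmf 0 else poisson_pmf rate)"

lemma pmf_Po: "0 \<le> rate \<Longrightarrow> pmf (Po rate) k = rate ^ k / fact k * exp (- rate)"
  by (auto simp: Po_def power_0_left)

end

theory Submission
  imports Defs
begin

text \<open>
  The number of copies \<open>W\<close> is a sum of indicators of weakly dependent events, one for each
  possible copy of \<open>G\<close>, and the proof is the Stein-Chen method for local dependence. For a set
  \<open>A\<close> of natural numbers let \<open>g\<close> solve \<open>l * g (j + 1) - j * g j = 1\<^sub>A(j) - Po(l)(A)\<close>.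
  Replacing \<open>j\<close> by a sum \<open>W\<close> of indicators with mean \<open>l\<close> and taking expectations expresses
  \<open>P(W \<in> A) - Po(l)(A)\<close> through increments of \<open>g\<close>, which are at most \<open>(1 - exp (- l)) / l\<close> in
  absolute value (\<open>stein_lipschitz\<close>). If each event is independent of all the events outside a
  neighbourhood of it, only the pairs of neighbouring events contribute, once with the product
  of their probabilities and once with their joint probability
  (\<open>poisson_local_dependence\<close>).

  In the graphon model, the probability that a given set of edges is present is the expectation
  of a product of values \<open>h (U u) (U v)\<close> over these edges (\<open>prob_contains\<close>). Hence copies on
  disjoint vertex sets are independent, and the neighbours of a copy are the copies that share a
  vertex with it. Given one copy, each edge of a second copy that is not in the first one costs
  at most a factor \<open>h_star\<close> (\<open>prob_contains_Un_le\<close>). If the two copies share \<open>s\<close> vertices, where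
  \<open>2 \<le> s < nv G\<close>, their common edges form a subgraph of \<open>G\<close> on at most \<open>s\<close> vertices, and the
  extremal quantities \<open>alpha G\<close> and \<open>gamma G\<close> say that at least \<open>kappa G s\<close> edges are new
  (\<open>kappa_le_overlap\<close>). With one common vertex all edges are new, and two different copies with
  the same vertex set differ in at least one edge.

  It remains to count. There are \<open>rho G\<close> copies on each vertex set, by orbit counting
  (\<open>card_copies_on\<close>), and the numbers of vertex sets that meet a given one, or meet it in exactly
  \<open>s\<close> vertices, are bounded by elementary binomial estimates. Summing over the neighbours of
  one copy gives at most \<open>mu h G * rho G\<close> times the last factor of the bound
  (\<open>local_dependence_term_le\<close>); summing over all copies turns \<open>mu h G\<close> into
  the mean, which cancels the denominator of \<open>(1 - exp (- l)) / l\<close>.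
\<close>

section \<open>The Stein equation for the Poisson distribution\<close>

text \<open>The weights \<open>pois l k\<close> are a plain function, so that sums and ratios of them can be
  handled by real arithmetic; they are the point masses of \<^const>\<open>Po\<close> at every rate
  \<open>l \<ge> 0\<close>.\<close>
definition pois :: "real \<Rightarrow> nat \<Rightarrow> real" where
  "pois l k = l ^ k / fact k * exp (- l)"

text \<open>The solution \<open>g\<close> of \<open>l * g (j + 1) - j * g j = 1\<^sub>A(j) - Po(l)(A)\<close>, obtained by
  multiplying the equation with \<open>pois l j\<close>, which makes the left-hand side a telescoping
  difference. The value at \<open>0\<close> is arbitrary, because the equation multiplies it by \<open>0\<close>.\<close>
definition stein :: "real \<Rightarrow> nat set \<Rightarrow> nat \<Rightarrow> real" where
  "stein l A j = (case j of 0 \<Rightarrow> 0 | Suc i \<Rightarrow>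
     (\<Sum>k\<le>i. (indicator A k - measure_pmf.prob (Po l) A) * pois l k) / (l * pois l i))"

lemma pois_pos: "0 < l \<Longrightarrow> 0 < pois l k"
  by (simp add: pois_def)

lemma pois_Suc: "real (Suc k) * pois l (Suc k) = l * pois l k"
  by (simp add: pois_def del: of_nat_Suc)

lemma pois_sums: "pois l sums 1"
proof -
  have "(\<lambda>k. l ^ k /\<^sub>R fact k * exp (- l)) sums (exp l * exp (- l))"
    by (intro sums_mult2 exp_converges)
  then show ?thesis
    by (simp add: pois_def[abs_def] divide_inverse mult.commute mult.left_commute
        flip: exp_add)
qed

lemma pmf_Po_pois: "0 \<le> l \<Longrightarrow> pmf (Po l) k = pois l k"
  by (simp add: pmf_Po pois_def)

lemma stein_equation:
  assumes "0 < l"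
  shows "l * stein l A (Suc j) - real j * stein l A j
           = indicator A j - measure_pmf.prob (Po l) A"
proof (cases j)
  case 0
  then show ?thesis using assms pois_pos[OF assms, of 0] by (simp add: stein_def)
next
  case (Suc i)
  define c where "c k = (indicator A k - measure_pmf.prob (Po l) A) * pois l k" for k
  have p: "0 < pois l i" "0 < pois l (Suc i)" using assms by (auto intro: pois_pos)
  have "real j * stein l A j = (\<Sum>k\<le>i. c k) / pois l j"
  proof -
    have "real j * pois l j = l * pois l i" using pois_Suc[of i l] Suc by simp
    then show ?thesis using p assms Suc unfolding stein_def c_def
      by (simp add: field_simps del: of_nat_Suc)
  qed
  moreover have "l * stein l A (Suc j) = (\<Sum>k\<le>j. c k) / pois l j"
    using assms by (simp add: stein_def c_def)
  ultimately have "l * stein l A (Suc j) - real j * stein l A j = c j / pois l j"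
    by (simp add: Suc flip: diff_divide_distrib)
  then show ?thesis using p Suc by (simp add: c_def)
qed

lemma prob_Po_atMost:
  assumes "0 \<le> l"
  shows "measure_pmf.prob (Po l) (A \<inter> {..j}) = (\<Sum>k\<le>j. indicator A k * pois l k)"
proof -
  have "measure_pmf.prob (Po l) (A \<inter> {..j}) = (\<Sum>k\<in>A \<inter> {..j}. pois l k)"
    by (simp add: measure_measure_pmf_finite pmf_Po_pois assms)
  also have "\<dots> = (\<Sum>k\<le>j. indicator A k * pois l k)"
    by (intro sum.mono_neutral_cong_left) (auto simp: indicator_def)
  finally show ?thesis .
qed

definition cdf_Po :: "real \<Rightarrow> nat \<Rightarrow> real" where
  "cdf_Po l j = (\<Sum>k\<le>j. pois l k)"

lemma tail_Po: "(\<lambda>k. pois l (k + Suc j)) sums (1 - cdf_Po l j)"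
  unfolding cdf_Po_def using sums_split_initial_segment[OF pois_sums, of l "Suc j"]
  by (simp add: lessThan_Suc_atMost)

text \<open>Both monotonicity statements about ratios below, and the last estimate of the Stein
  increments, come down to comparing \<open>\<Sum>k * pois l k\<close> with \<open>\<Sum>pois l k\<close> over an initial or
  final segment, where \<open>k\<close> is bounded by the end point of the segment.\<close>
lemma size_biased_cdf: "l * cdf_Po l j = (\<Sum>k\<le>Suc j. real k * pois l k)"
proof -
  have "(\<Sum>k\<le>Suc j. real k * pois l k) = (\<Sum>k\<le>j. real (Suc k) * pois l (Suc k))"
    by (subst sum.atMost_Suc_shift) simp
  then show ?thesis unfolding cdf_Po_def pois_Suc by (simp add: sum_distrib_left)
qed

lemma cdf_ratio_mono:
  assumes "0 < l"
  shows "cdf_Po l j / pois l j \<le> cdf_Po l (Suc j) / pois l (Suc j)"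
proof -
  have p: "0 < pois l j" "0 < pois l (Suc j)" using assms by (auto intro: pois_pos)
  have "l * cdf_Po l j \<le> real (Suc j) * cdf_Po l (Suc j)"
    unfolding size_biased_cdf unfolding cdf_Po_def sum_distrib_left
    by (intro sum_mono mult_right_mono) (use assms in \<open>auto intro: less_imp_le pois_pos\<close>)
  then have "(l * cdf_Po l j) * pois l j \<le> (real (Suc j) * cdf_Po l (Suc j)) * pois l j"
    using p by (intro mult_right_mono) auto
  also have "(l * cdf_Po l j) * pois l j = real (Suc j) * (cdf_Po l j * pois l (Suc j))"
    unfolding mult.left_commute[of "real (Suc j)"] pois_Suc by simp
  finally have "cdf_Po l j * pois l (Suc j) \<le> cdf_Po l (Suc j) * pois l j"
    by (simp only: mult.assoc mult_le_cancel_left_pos of_nat_0_less_iff zero_less_Suc)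
  then show ?thesis using p by (simp add: field_simps del: of_nat_Suc)
qed

lemma tail_ratio_antimono:
  assumes "0 < l"
  shows "(1 - cdf_Po l (Suc j)) / pois l (Suc j) \<le> (1 - cdf_Po l j) / pois l j"
proof -
  have p: "0 < pois l j" "0 < pois l (Suc j)" using assms by (auto intro: pois_pos)
  have "real (Suc j) * (1 - cdf_Po l (Suc j)) \<le> l * (1 - cdf_Po l j)"
  proof (rule sums_le)
    show "(\<lambda>k. real (Suc j) * pois l (k + Suc (Suc j))) sums (real (Suc j) * (1 - cdf_Po l (Suc j)))"
      by (intro sums_mult tail_Po)
    show "(\<lambda>k. l * pois l (k + Suc j)) sums (l * (1 - cdf_Po l j))"
      by (intro sums_mult tail_Po)
    show "real (Suc j) * pois l (k + Suc (Suc j)) \<le> l * pois l (k + Suc j)" for k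
      using pois_Suc[of "k + Suc j" l] pois_pos[OF assms, of "k + Suc (Suc j)"]
      by (auto intro!: mult_right_mono simp flip: pois_Suc)
  qed
  then have "(real (Suc j) * (1 - cdf_Po l (Suc j))) * pois l j \<le> (l * (1 - cdf_Po l j)) * pois l j"
    using p by (intro mult_right_mono) auto
  also have "(l * (1 - cdf_Po l j)) * pois l j = real (Suc j) * ((1 - cdf_Po l j) * pois l (Suc j))"
    unfolding mult.left_commute[of "real (Suc j)"] pois_Suc by simp
  finally have "(1 - cdf_Po l (Suc j)) * pois l j \<le> (1 - cdf_Po l j) * pois l (Suc j)"
    by (simp only: mult.assoc mult_le_cancel_left_pos of_nat_0_less_iff zero_less_Suc)
  then show ?thesis using p by (simp add: pos_divide_le_eq field_simps del: of_nat_Suc)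
qed

text \<open>Splitting \<open>A\<close> at \<open>j\<close> writes the solution as a combination of the two ratios whose
  monotonicity is known, with nonnegative coefficients that depend on \<open>A\<close>.\<close>
lemma stein_eq_split:
  assumes "0 < l"
  defines "P \<equiv> measure_pmf.prob (Po l)"
  shows "l * stein l A (Suc j) =
    P (A \<inter> {..j}) * ((1 - cdf_Po l j) / pois l j) - P (A \<inter> {j<..}) * (cdf_Po l j / pois l j)"
proof -
  have "P A = P (A \<inter> {..j}) + P (A \<inter> {j<..})"
    unfolding P_def by (subst measure_pmf.finite_measure_Union[symmetric])
      (auto intro!: arg_cong2[where f = measure])
  moreover have "l * stein l A (Suc j) = (P (A \<inter> {..j}) - P A * cdf_Po l j) / pois l j"
    using assms(1) unfolding P_def stein_def cdf_Po_def
    by (simp add: prob_Po_atMost left_diff_distrib sum_subtractf sum_distrib_left)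
  ultimately show ?thesis by (simp add: algebra_simps diff_divide_distrib add_divide_distrib)
qed

text \<open>Passing from \<open>i + 1\<close> to \<open>i + 2\<close> changes the formula for the split solution in three ways:
  the tail ratio in front of the points of \<open>A\<close> up to \<open>i\<close> decreases, the ratio subtracted for
  the points above \<open>i + 1\<close> increases, and the point \<open>i + 1\<close>, if it lies in \<open>A\<close>, moves from the
  upper to the lower part. Only the last change can raise the value, and it raises it by at
  most \<open>(1 - exp (- l)) / l\<close>.\<close>
lemma stein_increment_upper:
  assumes l: "0 < l"
  shows "stein l A (Suc (Suc i)) - stein l A (Suc i) \<le> (1 - exp (- l)) / l"
proof -
  define P where "P = measure_pmf.prob (Po l)"
  define a where "a j = (1 - cdf_Po l j) / pois l j" for j
  define b where "b j = cdf_Po l j / pois l j" for j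
  define d where "d = indicator A (Suc i) * pois l (Suc i)"
  have p: "0 < pois l i" "0 < pois l (Suc i)" using l by (auto intro: pois_pos)
  have d1: "P (A \<inter> {..Suc i}) = P (A \<inter> {..i}) + d"
    unfolding P_def d_def using l by (simp add: prob_Po_atMost)
  have "P A = P (A \<inter> {..j}) + P (A \<inter> {j<..})" for j
    unfolding P_def by (subst measure_pmf.finite_measure_Union[symmetric])
      (auto intro!: arg_cong2[where f = measure])
  from this[of i] this[of "Suc i"] have d2: "P (A \<inter> {i<..}) = P (A \<inter> {Suc i<..}) + d"
    using d1 by simp
  have "l * (stein l A (Suc (Suc i)) - stein l A (Suc i)) =
      P (A \<inter> {..i}) * (a (Suc i) - a i) - P (A \<inter> {Suc i<..}) * (b (Suc i) - b i)
      + d * (a (Suc i) + b i)"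
    unfolding right_diff_distrib stein_eq_split[OF l] P_def[symmetric] a_def[symmetric]
      b_def[symmetric] d1 d2 by (simp add: algebra_simps)
  also have "\<dots> \<le> d * (a (Suc i) + b i)"
    using tail_ratio_antimono[OF l, of i] cdf_ratio_mono[OF l, of i]
    by (simp add: a_def b_def P_def mult_le_0_iff)
       (smt (verit, best) measure_nonneg mult_nonneg_nonneg mult_nonneg_nonpos)
  also have "\<dots> \<le> pois l (Suc i) * (a (Suc i) + b i)"
  proof (rule mult_right_mono)
    show "d \<le> pois l (Suc i)" using p by (simp add: d_def indicator_def)
    have "0 \<le> 1 - cdf_Po l (Suc i)"
      using sums_le[OF _ sums_zero tail_Po[of l "Suc i"]] l by (simp add: pois_pos less_imp_le)
    then have "0 \<le> a (Suc i)"
      using p by (simp add: a_def)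
    moreover have "0 \<le> b i" unfolding b_def cdf_Po_def using p l
      by (intro divide_nonneg_nonneg sum_nonneg less_imp_le pois_pos) auto
    ultimately show "0 \<le> a (Suc i) + b i" by simp
  qed
  also have "\<dots> = 1 - cdf_Po l (Suc i) + (l * cdf_Po l i) / real (Suc i)"
  proof -
    have "pois l (Suc i) * b i = (l * cdf_Po l i) / real (Suc i)"
      using pois_Suc[of i l] p
      by (simp add: b_def field_simps del: of_nat_Suc)
    then show ?thesis using p by (simp add: distrib_left a_def)
  qed
  also have "l * cdf_Po l i / real (Suc i) \<le> cdf_Po l (Suc i) - exp (- l)"
  proof -
    have "l * cdf_Po l i = (\<Sum>k\<le>i. real (Suc k) * pois l (Suc k))"
      by (simp only: pois_Suc) (simp add: cdf_Po_def sum_distrib_left)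
    also have "\<dots> \<le> (\<Sum>k\<le>i. real (Suc i) * pois l (Suc k))"
      by (intro sum_mono mult_right_mono) (use l in \<open>auto intro: less_imp_le pois_pos\<close>)
    also have "\<dots> = real (Suc i) * (cdf_Po l (Suc i) - exp (- l))"
      unfolding cdf_Po_def sum.atMost_Suc_shift[of _ i]
      by (simp add: sum_distrib_left pois_def del: of_nat_Suc fact_Suc)
    finally show ?thesis by (simp add: field_simps del: of_nat_Suc)
  qed
  finally show ?thesis using l by (simp add: field_simps)
qed

text \<open>This symmetry turns the upper bound for the increments into a two-sided one.\<close>
lemma stein_Compl: "stein l (- A) j = - stein l A j"
proof -
  have compl: "measure_pmf.prob (Po l) (- A) = 1 - measure_pmf.prob (Po l) A"
    using measure_pmf.prob_compl[of A "Po l"] by (simp add: Compl_eq_Diff_UNIV)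
  have "(indicator (- A) k - measure_pmf.prob (Po l) (- A)) * pois l k
      = - ((indicator A k - measure_pmf.prob (Po l) A) * pois l k)" for k
    unfolding compl by (simp add: indicator_def algebra_simps)
  then show ?thesis
    by (simp add: stein_def sum_negf split: nat.split)
qed

text \<open>The bound is only claimed for positive arguments: the solution at \<open>0\<close> was an arbitrary
  choice.\<close>
lemma stein_lipschitz:
  assumes l: "0 < l"
  shows "\<bar>stein l A (Suc (i + m)) - stein l A (Suc i)\<bar> \<le> (1 - exp (- l)) / l * real m"
proof (induction m)
  case (Suc m)
  have "\<bar>stein l A (Suc (Suc (i + m))) - stein l A (Suc (i + m))\<bar> \<le> (1 - exp (- l)) / l"
    using stein_increment_upper[OF l, of A "i + m"] stein_increment_upper[OF l, of "- A" "i + m"]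
    by (simp add: stein_Compl)
  with Suc show ?case by (simp add: distrib_left)
qed simp

section \<open>Poisson approximation under local dependence\<close>

lemma (in prob_space) expectation_count:
  assumes "\<And>i. i \<in> I \<Longrightarrow> A i \<in> events"
  shows "expectation (\<lambda>\<omega>. real (\<Sum>i\<in>I. of_bool (\<omega> \<in> A i))) = (\<Sum>i\<in>I. prob (A i))"
proof -
  have [simp]: "of_bool (\<omega> \<in> A i) = (indicator (A i) \<omega> :: real)" for \<omega> i
    by (simp add: indicator_def)
  have "expectation (\<lambda>\<omega>. real (\<Sum>i\<in>I. of_bool (\<omega> \<in> A i))) = (\<Sum>i\<in>I. expectation (indicator (A i)))"
    unfolding of_nat_sum of_nat_of_bool using assms
    by (subst Bochner_Integration.integral_sum[symmetric])
      (auto intro!: integrable_real_indicator simp: emeasure_eq_measure)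
  also have "\<dots> = (\<Sum>i\<in>I. prob (A i))" using assms by (intro sum.cong) auto
  finally show ?thesis .
qed

text \<open>The Stein equation turns the difference of the two laws into the expectation of
  \<open>l * g (W + 1) - W * g W\<close>, that is, into the sum over \<open>i\<close> of
  \<open>P(A i) * E g (W + 1) - E (1\<^sub>A\<^sub>i * g W)\<close>. Let \<open>Z\<close> count the occurring events outside the
  neighbourhood \<open>N i\<close>. Both expectations are close to \<open>P(A i) * E g (Z + 1)\<close>, which by
  independence is also \<open>E (1\<^sub>A\<^sub>i * g (Z + 1))\<close>: in the first one \<open>W\<close> exceeds \<open>Z\<close> by the number
  of events occurring in \<open>N i\<close>, and in the second one, on \<open>A i\<close>, \<open>W - 1\<close> exceeds \<open>Z\<close> by
  the number of events other than \<open>A i\<close> occurring there. The Lipschitz bound for \<open>g\<close> gives the two sums.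
  At \<open>l = 0\<close> the factor \<open>(1 - exp (- l)) / l\<close> is \<open>0\<close>, which is right because then both
  laws are concentrated at \<open>0\<close>.\<close>
theorem (in prob_space) poisson_local_dependence:
  fixes A :: "'i \<Rightarrow> 'a set" and N :: "'i \<Rightarrow> 'i set"
  assumes fin: "finite I"
    and ev: "\<And>i. i \<in> I \<Longrightarrow> A i \<in> events"
    and N: "\<And>i. i \<in> I \<Longrightarrow> i \<in> N i \<and> N i \<subseteq> I"
    and indep: "\<And>i J. i \<in> I \<Longrightarrow> J \<subseteq> I - N i \<Longrightarrow>
       prob (A i \<inter> (space M \<inter> (\<Inter>j\<in>J. A j))) = prob (A i) * prob (space M \<inter> (\<Inter>j\<in>J. A j))"
  defines "W \<equiv> \<lambda>\<omega>. \<Sum>i\<in>I. of_bool (\<omega> \<in> A i) :: nat"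
  defines "l \<equiv> \<Sum>i\<in>I. prob (A i)"
  shows "\<bar>measure (law M W) B - measure_pmf.prob (Po l) B\<bar> \<le> (1 - exp (- l)) / l *
     (\<Sum>i\<in>I. (\<Sum>j\<in>N i. prob (A i) * prob (A j)) + (\<Sum>j\<in>N i - {i}. prob (A i \<inter> A j)))"
proof -
  define X where "X J \<omega> = (\<Sum>j\<in>J. of_bool (\<omega> \<in> A j) :: nat)" for J \<omega>
  have W_X: "W = X I" by (simp add: W_def X_def fun_eq_iff)
  have X_meas: "X J \<in> measurable M (count_space UNIV)" if "J \<subseteq> I" for J
  proof -
    have "finite J" using that fin finite_subset by blast
    moreover have [measurable]: "Measurable.pred M (\<lambda>x. x \<in> A j)" if "j \<in> J" for j
      using ev that \<open>J \<subseteq> I\<close> by (auto intro: pred_sets2)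
    ultimately show ?thesis unfolding X_def by measurable
  qed
  have X_le: "X J \<omega> \<le> card I" if "J \<subseteq> I" for J \<omega>
  proof -
    have "X J \<omega> \<le> (\<Sum>j\<in>J. 1)" unfolding X_def by (intro sum_mono) auto
    also have "\<dots> \<le> card I" using that fin by (simp add: card_mono)
    finally show ?thesis .
  qed
  have int_X: "integrable M (\<lambda>\<omega>. f (X J \<omega>) :: real)" if "J \<subseteq> I" for f J
  proof (rule integrable_const_bound[where B = "Max ((\<lambda>k. \<bar>f k\<bar>) ` {..card I})"])
    show "AE \<omega> in M. norm (f (X J \<omega>)) \<le> Max ((\<lambda>k. \<bar>f k\<bar>) ` {..card I})"
      using X_le[OF that] by (intro AE_I2) (auto intro!: Max_ge)
    show "(\<lambda>\<omega>. f (X J \<omega>)) \<in> borel_measurable M"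
      using X_meas[OF that] by measurable
  qed
  have int_iX: "integrable M (\<lambda>\<omega>. indicator (A i) \<omega> * f (X J \<omega>) :: real)"
    if "J \<subseteq> I" "i \<in> I" for f J i
    using integrable_mult_indicator[OF ev[OF that(2)] int_X[OF that(1), of f]] by simp
  have expect_X: "expectation (\<lambda>\<omega>. real (X J \<omega>)) = (\<Sum>j\<in>J. prob (A j))" if "J \<subseteq> I" for J
    unfolding X_def using that ev by (intro expectation_count) auto
  show ?thesis
  proof (cases "l = 0")
    case True
    have "AE \<omega> in M. \<omega> \<notin> A i" if "i \<in> I" for i
    proof -
      have "prob (A i) = 0" using True that fin unfolding l_def
        by (simp add: sum_nonneg_eq_0_iff)
      then show ?thesis using prob_eq_0[OF ev[OF that]] by simp
    qed
    then have "AE \<omega> in M. W \<omega> = 0"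
      unfolding W_def using AE_finite_allI[OF fin, of "\<lambda>i \<omega>. \<omega> \<notin> A i" M]
      by (auto elim!: eventually_mono)
    then have "law M W = law M (\<lambda>_. 0)"
      unfolding law_def using X_meas[of I] by (intro distr_cong_AE) (auto simp: W_X)
    then have "measure (law M W) B = indicator B 0"
      by (simp add: law_def measure_return) 
    moreover have "measure_pmf.prob (Po 0) B = indicator B 0"
      by (simp add: Po_def measure_return_pmf)
    ultimately show ?thesis using True by simp
  next
    case False
    then have l: "0 < l" unfolding l_def by (simp add: sum_nonneg less_le)
    define c where "c = (1 - exp (- l)) / l"
    have c: "0 \<le> c" using l by (simp add: c_def)
    define g where "g k = stein l B (Suc k)" for k
    have lip: "\<bar>g (i + m) - g i\<bar> \<le> c * real m" for i m
      unfolding g_def c_def by (rule stein_lipschitz[OF l])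
    have Z: "expectation (\<lambda>\<omega>. indicator (A i) \<omega> * g (X (I - N i) \<omega>))
        = prob (A i) * expectation (\<lambda>\<omega>. g (X (I - N i) \<omega>))" if i: "i \<in> I" for i
    proof -
      let ?J = "I - N i"
      \<comment> \<open>The intersections of events outside \<open>N i\<close> are stable under intersection, so independence
        of \<open>A i\<close> from them extends to the sigma-algebra they generate, which makes \<open>Z\<close> measurable.\<close>
      define \<B> where "\<B> = (\<lambda>J. space M \<inter> (\<Inter>j\<in>J. A j)) ` Pow ?J"
      have \<B>_ev: "\<B> \<subseteq> events"
      proof
        fix b assume "b \<in> \<B>"
        then obtain J where J: "J \<subseteq> ?J" "b = space M \<inter> (\<Inter>j\<in>J. A j)" by (auto simp: \<B>_def)
        then have "finite J" using fin finite_subset by blast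
        then show "b \<in> events" using J ev
          by (cases "J = {}") (auto intro!: sets.Int sets.finite_INT)
      qed
      have "indep_set {A i} \<B>"
        unfolding indep_set_def indep_sets_def
      proof (intro conjI ballI allI impI)
        fix j :: bool assume "j \<in> UNIV"
        show "case_bool {A i} \<B> j \<subseteq> events" using ev[OF i] \<B>_ev by (cases j) auto
      next
        fix J :: "bool set" and E assume J: "J \<subseteq> UNIV" "J \<noteq> {}" "finite J"
          "E \<in> Pi J (case_bool {A i} \<B>)"
        have "J \<in> Pow {True, False}" by auto
        then have "J = {True} \<or> J = {False} \<or> J = {True, False}"
          using J(2) unfolding Pow_insert Pow_empty by blast
        then show "prob (\<Inter> (E ` J)) = (\<Prod>j\<in>J. prob (E j))"
        proof (elim disjE)
          assume 3: "J = {True, False}"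
          then have "E True = A i" "E False \<in> \<B>" using J(4) by auto
          then show ?thesis using 3 indep[OF i] by (auto simp: \<B>_def)
        qed auto
      qed
      then have ind: "indep_set (sigma_sets (space M) {A i}) (sigma_sets (space M) \<B>)"
      proof (rule indep_set_sigma_sets)
        show "Int_stable {A i}" by (auto simp: Int_stable_def)
        show "Int_stable \<B>"
        proof (rule Int_stableI)
          fix a b assume "a \<in> \<B>" "b \<in> \<B>"
          then obtain J J' where "J \<subseteq> ?J" "J' \<subseteq> ?J" 
            "a = space M \<inter> (\<Inter>j\<in>J. A j)" "b = space M \<inter> (\<Inter>j\<in>J'. A j)" by (auto simp: \<B>_def)
          then show "a \<inter> b \<in> \<B>" unfolding \<B>_def by (intro image_eqI[of _ _ "J \<union> J'"]) auto
        qed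
      qed
      have sp: "\<B> \<subseteq> Pow (space M)" by (auto simp: \<B>_def)
      have Xs: "X ?J \<in> measurable (sigma (space M) \<B>) (count_space UNIV)"
      proof -
        have [measurable]: "Measurable.pred (sigma (space M) \<B>) (\<lambda>x. x \<in> A j)" if "j \<in> ?J" for j
        proof (rule pred_sets2)
          have "A j = space M \<inter> (\<Inter>j\<in>{j}. A j)" using ev that sets.sets_into_space by blast
          then have "A j \<in> \<B>" unfolding \<B>_def using that by blast
          then show "A j \<in> sets (sigma (space M) \<B>)" using sp by auto
        qed auto
        show ?thesis unfolding X_def using fin by measurable
      qed
      have ki: "prob (A i \<inter> (X ?J -` {k} \<inter> space M)) = prob (A i) * prob (X ?J -` {k} \<inter> space M)" for k
      proof -
        have "X ?J -` {k} \<inter> space M \<in> sigma_sets (space M) \<B>"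
          using measurable_sets[OF Xs, of "{k}"] sp by simp
        moreover have "A i \<in> sigma_sets (space M) {A i}" by auto
        ultimately show ?thesis using indep_setD[OF ind] by blast
      qed
      have evk: "X ?J -` {k} \<inter> space M \<in> events" for k
        using measurable_sets[OF X_meas[of ?J], of "{k}"] by auto
      \<comment> \<open>\<open>Z\<close> has finitely many values, so \<open>g Z\<close> is a finite combination of indicators of its level
        sets.\<close>
      have dec: "g (X ?J \<omega>) = (\<Sum>k\<le>card I. g k * indicator (X ?J -` {k} \<inter> space M) \<omega>)"
        if "\<omega> \<in> space M" for \<omega>
        using X_le[of ?J \<omega>] that
        by (subst sum.mono_neutral_right[of _ "{X ?J \<omega>}"]) (auto simp: indicator_def)
      have "expectation (\<lambda>\<omega>. indicator (A i) \<omega> * g (X ?J \<omega>))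
          = expectation (\<lambda>\<omega>. \<Sum>k\<le>card I. g k * indicator (A i \<inter> (X ?J -` {k} \<inter> space M)) \<omega>)"
      proof (intro Bochner_Integration.integral_cong refl)
        fix \<omega> assume \<omega>: "\<omega> \<in> space M"
        show "indicator (A i) \<omega> * g (X ?J \<omega>)
            = (\<Sum>k\<le>card I. g k * indicator (A i \<inter> (X ?J -` {k} \<inter> space M)) \<omega>)"
          unfolding dec[OF \<omega>] sum_distrib_left indicator_inter_arith
          by (intro sum.cong refl mult.left_commute)
      qed
      also have "\<dots> = (\<Sum>k\<le>card I. g k * prob (A i \<inter> (X ?J -` {k} \<inter> space M)))"
        using ev[OF i] evk
        by (subst Bochner_Integration.integral_sum) 
          (auto intro!: integrable_mult_right integrable_real_indicator simp: emeasure_eq_measure)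
      also have "\<dots> = prob (A i) * (\<Sum>k\<le>card I. g k * prob (X ?J -` {k} \<inter> space M))"
        unfolding ki by (simp add: sum_distrib_left mult.left_commute)
      also have "(\<Sum>k\<le>card I. g k * prob (X ?J -` {k} \<inter> space M))
          = expectation (\<lambda>\<omega>. \<Sum>k\<le>card I. g k * indicator (X ?J -` {k} \<inter> space M) \<omega>)"
        using evk
        by (subst Bochner_Integration.integral_sum) 
          (auto intro!: integrable_mult_right integrable_real_indicator simp: emeasure_eq_measure)
      also have "\<dots> = expectation (\<lambda>\<omega>. g (X ?J \<omega>))"
        by (intro Bochner_Integration.integral_cong) (auto simp: dec)
      finally show ?thesis .
    qed
    have term_bound: "\<bar>prob (A i) * expectation (\<lambda>\<omega>. g (X I \<omega>))
          - expectation (\<lambda>\<omega>. indicator (A i) \<omega> * stein l B (X I \<omega>))\<bar>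
        \<le> c * ((\<Sum>j\<in>N i. prob (A i) * prob (A j)) + (\<Sum>j\<in>N i - {i}. prob (A i \<inter> A j)))"
      if i: "i \<in> I" for i
    proof -
      let ?J = "I - N i" and ?K = "I - {i}"
      have sub: "?J \<subseteq> I" "N i \<subseteq> I" "?K \<subseteq> I" "N i - {i} \<subseteq> I" using N[OF i] by auto
      have fN: "finite (N i)" using sub fin finite_subset by blast
      have split1: "X I \<omega> = X ?J \<omega> + X (N i) \<omega>" for \<omega>
        unfolding X_def using sub(2) fin by (rule sum.subset_diff)
      have split2: "X ?K \<omega> = X ?J \<omega> + X (N i - {i}) \<omega>" for \<omega>
      proof -
        have "?K = ?J \<union> (N i - {i})" using N[OF i] by auto
        then show ?thesis unfolding X_def using fin fN by (simp only:) (rule sum.union_disjoint, auto)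
      qed
      \<comment> \<open>On \<open>A i\<close> the event itself contributes \<open>1\<close> to \<open>W\<close>; this is the shift that replaces
        the solution at \<open>W\<close> by \<open>g\<close> at the count of the other events.\<close>
      have on_Ai: "indicator (A i) \<omega> * stein l B (X I \<omega>) = indicator (A i) \<omega> * g (X ?K \<omega>)" for \<omega>
        using fin i unfolding X_def g_def
        by (cases "\<omega> \<in> A i") (simp_all add: sum.remove del: sum_of_bool_eq)
      have "\<bar>expectation (\<lambda>\<omega>. g (X I \<omega>)) - expectation (\<lambda>\<omega>. g (X ?J \<omega>))\<bar>
          = \<bar>expectation (\<lambda>\<omega>. g (X I \<omega>) - g (X ?J \<omega>))\<bar>"
        using sub by (subst Bochner_Integration.integral_diff) (auto intro: int_X)
      also have "\<dots> \<le> expectation (\<lambda>\<omega>. c * real (X (N i) \<omega>))"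
      proof (rule order_trans[OF integral_abs_bound integral_mono])
        show "integrable M (\<lambda>x. \<bar>g (X I x) - g (X ?J x)\<bar>)"
          using sub by (intro integrable_abs Bochner_Integration.integrable_diff int_X) auto
        show "integrable M (\<lambda>\<omega>. c * real (X (N i) \<omega>))" using int_X[OF sub(2)] .
        show "\<bar>g (X I x) - g (X ?J x)\<bar> \<le> c * real (X (N i) x)" for x
          unfolding split1 by (rule lip)
      qed
      also have "\<dots> = c * (\<Sum>j\<in>N i. prob (A j))" using expect_X[OF sub(2)] by simp
      finally have 1: "prob (A i) * \<bar>expectation (\<lambda>\<omega>. g (X I \<omega>)) - expectation (\<lambda>\<omega>. g (X ?J \<omega>))\<bar>
          \<le> prob (A i) * (c * (\<Sum>j\<in>N i. prob (A j)))"
        by (intro mult_left_mono) auto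
      have "\<bar>expectation (\<lambda>\<omega>. indicator (A i) \<omega> * g (X ?K \<omega>))
            - expectation (\<lambda>\<omega>. indicator (A i) \<omega> * g (X ?J \<omega>))\<bar>
          = \<bar>expectation (\<lambda>\<omega>. indicator (A i) \<omega> * g (X ?K \<omega>) - indicator (A i) \<omega> * g (X ?J \<omega>))\<bar>"
        using sub i by (subst Bochner_Integration.integral_diff) (auto intro: int_iX)
      also have "\<dots> \<le> expectation (\<lambda>\<omega>. c * (indicator (A i) \<omega> * real (X (N i - {i}) \<omega>)))"
      proof (rule order_trans[OF integral_abs_bound integral_mono])
        show "integrable M (\<lambda>x. \<bar>indicator (A i) x * g (X ?K x) - indicator (A i) x * g (X ?J x)\<bar>)"
          using sub i by (intro integrable_abs Bochner_Integration.integrable_diff int_iX) auto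
        show "integrable M (\<lambda>\<omega>. c * (indicator (A i) \<omega> * real (X (N i - {i}) \<omega>)))"
          using int_iX[OF sub(4) i, of real] by simp
        show "\<bar>indicator (A i) x * g (X ?K x) - indicator (A i) x * g (X ?J x)\<bar>
            \<le> c * (indicator (A i) x * real (X (N i - {i}) x))" for x
          using lip[of "X ?J x" "X (N i - {i}) x"] unfolding split2 by (simp add: indicator_def)
      qed
      also have "\<dots> = c * (\<Sum>j\<in>N i - {i}. prob (A i \<inter> A j))"
      proof -
        have "indicator (A i) \<omega> * real (X (N i - {i}) \<omega>)
            = (\<Sum>j\<in>N i - {i}. indicator (A i \<inter> A j) \<omega>)" for \<omega>
          unfolding X_def of_nat_sum of_nat_of_bool
          by (simp add: sum_distrib_left indicator_def of_bool_def del: sum_of_bool_eq)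
        then have "expectation (\<lambda>\<omega>. indicator (A i) \<omega> * real (X (N i - {i}) \<omega>))
            = (\<Sum>j\<in>N i - {i}. expectation (indicator (A i \<inter> A j)))"
          using sub i ev by (simp, subst Bochner_Integration.integral_sum)
            (auto intro!: integrable_real_indicator simp: emeasure_eq_measure)
        also have "\<dots> = (\<Sum>j\<in>N i - {i}. prob (A i \<inter> A j))"
          using sub i ev by (intro sum.cong) auto
        finally show ?thesis by simp
      qed
      finally have 2: "\<bar>expectation (\<lambda>\<omega>. indicator (A i) \<omega> * g (X ?K \<omega>))
            - expectation (\<lambda>\<omega>. indicator (A i) \<omega> * g (X ?J \<omega>))\<bar>
            \<le> c * (\<Sum>j\<in>N i - {i}. prob (A i \<inter> A j))" .
      have "\<bar>prob (A i) * expectation (\<lambda>\<omega>. g (X I \<omega>))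
          - expectation (\<lambda>\<omega>. indicator (A i) \<omega> * g (X ?K \<omega>))\<bar>
         \<le> \<bar>prob (A i) * (expectation (\<lambda>\<omega>. g (X I \<omega>)) - expectation (\<lambda>\<omega>. g (X ?J \<omega>)))\<bar> +
          \<bar>expectation (\<lambda>\<omega>. indicator (A i) \<omega> * g (X ?K \<omega>))
            - expectation (\<lambda>\<omega>. indicator (A i) \<omega> * g (X ?J \<omega>))\<bar>"
        unfolding Z[OF i] by (simp add: right_diff_distrib)
      also have "\<dots> \<le> prob (A i) * (c * (\<Sum>j\<in>N i. prob (A j)))
          + c * (\<Sum>j\<in>N i - {i}. prob (A i \<inter> A j))"
        using 1 2 by (simp add: abs_mult)
      finally show ?thesis
        unfolding on_Ai by (simp add: algebra_simps sum_distrib_left)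
    qed
    have "measure (law M W) B - measure_pmf.prob (Po l) B
        = expectation (\<lambda>\<omega>. indicator B (X I \<omega>) - measure_pmf.prob (Po l) B)"
    proof -
      have "measure (law M W) B = prob (X I -` B \<inter> space M)"
        unfolding law_def W_X using X_meas[of I] by (simp add: measure_distr)
      also have "\<dots> = expectation (indicator (X I -` B \<inter> space M))"
        using measurable_sets[OF X_meas[of I], of B] by simp
      also have "\<dots> = expectation (\<lambda>\<omega>. indicator B (X I \<omega>))"
        by (intro Bochner_Integration.integral_cong) (auto simp: indicator_def)
      finally show ?thesis
        by (subst Bochner_Integration.integral_diff) (auto simp: prob_space intro: int_X)
    qed
    also have "\<dots> = expectation (\<lambda>\<omega>. l * g (X I \<omega>) - real (X I \<omega>) * stein l B (X I \<omega>))"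
      unfolding g_def stein_equation[OF l] by simp
    also have "\<dots> = (\<Sum>i\<in>I. prob (A i) * expectation (\<lambda>\<omega>. g (X I \<omega>))
          - expectation (\<lambda>\<omega>. indicator (A i) \<omega> * stein l B (X I \<omega>)))"
    proof -
      have "real (X I \<omega>) * stein l B (X I \<omega>) = (\<Sum>i\<in>I. indicator (A i) \<omega> * stein l B (X I \<omega>))" for \<omega>
        unfolding sum_distrib_right[symmetric] X_def of_nat_sum of_nat_of_bool
        by (simp add: indicator_def of_bool_def del: sum_of_bool_eq)
      then have "expectation (\<lambda>\<omega>. real (X I \<omega>) * stein l B (X I \<omega>))
          = (\<Sum>i\<in>I. expectation (\<lambda>\<omega>. indicator (A i) \<omega> * stein l B (X I \<omega>)))"
        by (simp, subst Bochner_Integration.integral_sum) (auto intro: int_iX)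
      then show ?thesis
        by (subst Bochner_Integration.integral_diff)
           (auto intro: int_X simp: sum_subtractf l_def[symmetric] sum_distrib_right[symmetric])
    qed
    finally have "\<bar>measure (law M W) B - measure_pmf.prob (Po l) B\<bar>
        \<le> (\<Sum>i\<in>I. c * ((\<Sum>j\<in>N i. prob (A i) * prob (A j)) + (\<Sum>j\<in>N i - {i}. prob (A i \<inter> A j))))"
      by (simp only:) (intro order_trans[OF sum_abs] sum_mono term_bound)
    then show ?thesis by (simp only: c_def sum_distrib_left)
  qed
qed

section \<open>Copies of a graph\<close>

lemma finite_all_pairs: "finite S \<Longrightarrow> finite (all_pairs S)"
  by (rule finite_subset[of _ "Pow S"]) (auto simp: all_pairs_def)

lemma all_pairs_mono: "S \<subseteq> T \<Longrightarrow> all_pairs S \<subseteq> all_pairs T"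
  by (auto simp: all_pairs_def)

lemma simple_graph_finite: "simple_graph G \<Longrightarrow> finite (verts G) \<and> finite (edges G)"
  unfolding simple_graph_def using finite_all_pairs finite_subset by blast

lemma copies_onD:
  assumes "simple_graph G" "finite S" "card S = nv G" "G' \<in> copies_on G S"
  shows "verts G' = S" "edges G' \<subseteq> all_pairs S" "ne G' = ne G"
    and "\<exists>f. bij_betw f (verts G) S \<and> (\<lambda>e. f ` e) ` edges G = edges G'"
proof -
  have sub: "verts G' \<subseteq> S" "simple_graph G'"
    using assms(4) by (auto simp: copies_on_def subgraph_def complete_graph_def)
  obtain f where f: "bij_betw f (verts G) (verts G')" "(\<lambda>e. f ` e) ` edges G = edges G'"
    using assms(4) by (auto simp: copies_on_def isomorphic_def)
  then have "nv G' = card S" using assms(3) bij_betw_same_card by metis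
  then show v: "verts G' = S" using sub assms(2) card_subset_eq by blast
  then show "edges G' \<subseteq> all_pairs S" using sub by (simp add: simple_graph_def)
  have "inj_on (\<lambda>e. f ` e) (edges G)"
  proof (rule inj_on_subset[OF inj_on_image_Pow])
    show "inj_on f (verts G)" using f(1) by (simp add: bij_betw_def)
    show "edges G \<subseteq> Pow (verts G)" using assms(1) by (auto simp: simple_graph_def all_pairs_def)
  qed
  then show "ne G' = ne G" using f(2) card_image by metis
  show "\<exists>f. bij_betw f (verts G) S \<and> (\<lambda>e. f ` e) ` edges G = edges G'" using f v by auto
qed

lemma finite_copies_on:
  assumes "finite S"
  shows "finite (copies_on G S)"
proof (rule finite_subset)
  show "copies_on G S \<subseteq> Pow S \<times> Pow (all_pairs S)"
    by (auto simp: copies_on_def subgraph_def complete_graph_def)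
  show "finite (Pow S \<times> Pow (all_pairs S))" using assms by (simp add: finite_all_pairs)
qed

text \<open>Orbit counting: after identifying the vertex set of \<open>G\<close> with \<open>S\<close> by a bijection \<open>b\<close>, the
  permutations of the vertices map onto the copies of \<open>G\<close> on \<open>S\<close>, and every fibre of this map
  is a coset of the automorphism group.\<close>
lemma card_copies_on:
  assumes G: "simple_graph G" and S: "finite S" "card S = nv G"
  shows "real (card (copies_on G S)) = rho G"
proof -
  let ?V = "verts G" and ?E = "edges G" and ?Sym = "{p. p permutes verts G}"
  have fV: "finite ?V" and EV: "\<And>e. e \<in> ?E \<Longrightarrow> e \<subseteq> ?V" "\<And>e. e \<in> ?E \<Longrightarrow> card e = 2"
    using G by (auto simp: simple_graph_def all_pairs_def)
  obtain b where b: "bij_betw b ?V S"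
    using S fV finite_same_card_bij by metis
  define P where "P p = (S, (\<lambda>e. (b \<circ> p) ` e) ` ?E)" for p
  have bp: "bij_betw (b \<circ> p) ?V S" if "p permutes ?V" for p
    using b that bij_betw_trans permutes_imp_bij by blast
  have P_in: "P p \<in> copies_on G S" if p: "p permutes ?V" for p
  proof -
    have "(b \<circ> p) ` e \<in> all_pairs S" if "e \<in> ?E" for e
    proof -
      have "inj_on (b \<circ> p) e" using bp[OF p] EV(1)[OF that] by (meson bij_betw_def inj_on_subset)
      then have "card ((b \<circ> p) ` e) = 2" using EV(2)[OF that] by (simp only: card_image)
      then show ?thesis using bp[OF p] EV(1)[OF that] by (auto simp: all_pairs_def bij_betw_def)
    qed
    then show ?thesis unfolding copies_on_def subgraph_def complete_graph_def simple_graph_def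
        isomorphic_def P_def using S bp[OF p] by auto
  qed
  have surj: "P ` ?Sym = copies_on G S"
  proof (intro equalityI subsetI)
    fix G' assume G': "G' \<in> copies_on G S"
    from copies_onD[OF G S G'] obtain f where f: "bij_betw f ?V S"
      "(\<lambda>e. f ` e) ` ?E = edges G'" and v: "verts G' = S" by blast
    define p where "p x = (if x \<in> ?V then inv_into ?V b (f x) else x)" for x
    have "bij_betw (inv_into ?V b \<circ> f) ?V ?V"
      using f(1) bij_betw_inv_into[OF b] bij_betw_trans by blast
    then have "bij_betw p ?V ?V" by (rule bij_betw_cong[THEN iffD1, rotated]) (simp add: p_def)
    then have p: "p permutes ?V" by (rule bij_imp_permutes) (simp add: p_def)
    have "b (p x) = f x" if "x \<in> ?V" for x
      using that f(1) b by (auto simp: p_def bij_betw_def f_inv_into_f)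
    then have "(b \<circ> p) ` e = f ` e" if "e \<in> ?E" for e
      using EV(1)[OF that] by (intro image_cong) auto
    then have "P p = G'" using f(2) v by (auto simp: P_def prod_eq_iff intro: rev_image_eqI)
    with p show "G' \<in> P ` ?Sym" by auto
  qed (use P_in in auto)
  have fibre: "card {q \<in> ?Sym. P q = P p} = card (automorphisms G)" if p: "p permutes ?V" for p
  proof -
    have assoc: "(\<lambda>e. (b \<circ> p) ` e) ` ((\<lambda>e. a ` e) ` ?E) = (\<lambda>e. (b \<circ> (p \<circ> a)) ` e) ` ?E" for a
      by (simp add: image_image o_def)
    have "{q \<in> ?Sym. P q = P p} = (\<lambda>a. p \<circ> a) ` automorphisms G"
    proof (intro equalityI subsetI)
      fix q assume q: "q \<in> {q \<in> ?Sym. P q = P p}"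
      let ?a = "inv p \<circ> q"
      have a: "?a permutes ?V" using q p by (auto intro: permutes_compose permutes_inv)
      have inj: "inj_on (\<lambda>e. (b \<circ> p) ` e) (Pow ?V)"
        using bp[OF p] by (intro inj_on_image_Pow) (simp add: bij_betw_def)
      have pa: "p \<circ> ?a = q" using p by (auto simp: fun_eq_iff permutes_inverses)
      have "(\<lambda>e. (b \<circ> p) ` e) ` ((\<lambda>e. ?a ` e) ` ?E) = (\<lambda>e. (b \<circ> q) ` e) ` ?E"
        using assoc[of ?a] unfolding pa .
      also have "\<dots> = (\<lambda>e. (b \<circ> p) ` e) ` ?E" using q by (simp add: P_def)
      finally have "(\<lambda>e. ?a ` e) ` ?E = ?E"
      proof (rule inj_on_image_eq_iff[OF inj, THEN iffD1, rotated 2])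
        show "(\<lambda>e. ?a ` e) ` ?E \<subseteq> Pow ?V"
          using EV(1) permutes_image[OF a] by fastforce
        show "?E \<subseteq> Pow ?V" using EV by auto
      qed
      then have "?a \<in> automorphisms G" using a by (simp add: automorphisms_def)
      then show "q \<in> (\<lambda>a. p \<circ> a) ` automorphisms G" using pa by (metis image_eqI)
    next
      fix q assume "q \<in> (\<lambda>a. p \<circ> a) ` automorphisms G"
      then obtain a where a: "a permutes ?V" "(\<lambda>e. a ` e) ` ?E = ?E" "q = p \<circ> a"
        by (auto simp: automorphisms_def)
      have "(\<lambda>e. (b \<circ> q) ` e) ` ?E = (\<lambda>e. (b \<circ> p) ` e) ` ((\<lambda>e. a ` e) ` ?E)"
        unfolding a(3) assoc ..
      then show "q \<in> {q \<in> ?Sym. P q = P p}"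
        using a p by (auto simp: P_def intro: permutes_compose)
    qed
    moreover have "inj_on (\<lambda>a. p \<circ> a) (automorphisms G)"
      using p by (intro inj_onI) (metis (no_types) comp_assoc id_comp permutes_inv_o(2))
    ultimately show ?thesis by (simp add: card_image)
  qed
  have "fact (nv G) = card ?Sym" using card_permutations[OF refl fV] by simp
  also have "\<dots> = (\<Sum>y\<in>P ` ?Sym. card {q \<in> ?Sym. P q = y})"
    using sum.image_gen[of ?Sym "\<lambda>_. 1 :: nat" P] finite_permutations[OF fV] by simp
  also have "\<dots> = (\<Sum>y\<in>P ` ?Sym. card (automorphisms G))"
    using fibre by (intro sum.cong) auto
  finally have "fact (nv G) = card (copies_on G S) * card (automorphisms G)"
    by (simp add: surj)
  then have eq: "(fact (nv G) :: real) = real (card (copies_on G S)) * real (card (automorphisms G))"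
    by (metis of_nat_fact of_nat_mult)
  then have "card (automorphisms G) \<noteq> 0" by (metis fact_nonzero mult_zero_right of_nat_0)
  then show ?thesis unfolding rho_def eq by simp
qed

section \<open>Overlaps of two copies\<close>

lemma finite_proper_subgraphs:
  assumes "simple_graph G"
  shows "finite (proper_subgraphs G)"
proof (rule finite_subset)
  show "proper_subgraphs G \<subseteq> Pow (verts G) \<times> Pow (edges G)"
    by (auto simp: proper_subgraphs_def subgraph_def)
  show "finite (Pow (verts G) \<times> Pow (edges G))" using simple_graph_finite[OF assms] by simp
qed

lemma edge_set_subgraph:
  assumes G: "simple_graph G" and F: "F \<subseteq> edges G" "F \<noteq> {}" "card (\<Union>F) < nv G"
  shows "(\<Union>F, F) \<in> proper_subgraphs G" "no_isolated (\<Union>F, F)"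
proof -
  have UF: "\<Union>F \<subseteq> verts G" using G F(1) by (auto simp: simple_graph_def all_pairs_def)
  then have "finite (\<Union>F)" using simple_graph_finite[OF G] finite_subset by blast
  moreover have "F \<subseteq> all_pairs (\<Union>F)" using G F(1) by (fastforce simp: simple_graph_def all_pairs_def)
  moreover have "\<Union>F \<noteq> {}" 
  proof -
    obtain e where "e \<in> F" "card e = 2" using F(1,2) G by (auto simp: simple_graph_def all_pairs_def)
    then show ?thesis by (metis Union_upper card.empty subset_empty zero_neq_numeral)
  qed
  ultimately show "(\<Union>F, F) \<in> proper_subgraphs G"
    unfolding proper_subgraphs_def subgraph_def simple_graph_def using F UF by auto
  show "no_isolated (\<Union>F, F)" by (auto simp: no_isolated_def)
qed

text \<open>The edges \<open>F\<close> with their end points form a subgraph \<open>H\<close> over which both minima range. The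
  minimum \<^const>\<open>gamma\<close> bounds the number of edges of \<open>H\<close> from above, and \<^const>\<open>alpha\<close>
  bounds the number of edges outside \<open>H\<close> from below by a multiple of the number of vertices
  outside \<open>H\<close>. In both bounds the number of vertices of \<open>H\<close> may be replaced by the larger \<open>s\<close>, since \<open>edge_density G\<close> and \<open>alpha G\<close> are
  nonnegative.\<close>
lemma kappa_le_nonempty:
  assumes G: "simple_graph G" and F: "F \<subseteq> edges G" "F \<noteq> {}"
    and s: "card (\<Union>F) \<le> s" "s < nv G"
  shows "kappa G s \<le> real (ne G) - real (card F)"
proof -
  let ?H = "(\<Union>F, F)"
  have H: "?H \<in> proper_subgraphs G" "no_isolated ?H"
    using edge_set_subgraph[OF G F] s by auto
  have d: "0 \<le> edge_density G" by (simp add: edge_density_def)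
  let ?C = "{edge_density G * real (nv H) - real (ne H) | H. H \<in> proper_subgraphs G \<and> no_isolated H}"
  have "?C = (\<lambda>H. edge_density G * real (nv H) - real (ne H)) ` {H \<in> proper_subgraphs G. no_isolated H}"
    by blast
  then have "finite ?C" using finite_proper_subgraphs[OF G] by simp
  then have "gamma G \<le> edge_density G * real (nv ?H) - real (ne ?H)"
    unfolding gamma_def by (rule Min_le) (use H in blast)
  also have "\<dots> \<le> edge_density G * real s - real (card F)"
    using s d by (simp add: mult_left_mono)
  finally have 1: "real (ne G) - real s * edge_density G + gamma G \<le> real (ne G) - real (card F)"
    by (simp add: mult.commute)
  let ?B = "{(real (ne G) - real (ne H)) / (real (nv G) - real (nv H)) | H.
     H \<in> proper_subgraphs G \<and> no_isolated H \<and> nv H \<noteq> nv G}"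
  have "?B = (\<lambda>H. (real (ne G) - real (ne H)) / (real (nv G) - real (nv H))) `
      {H \<in> proper_subgraphs G. no_isolated H \<and> nv H \<noteq> nv G}" by blast
  then have fB: "finite ?B" using finite_proper_subgraphs[OF G] by simp
  have inB: "(real (ne G) - real (ne ?H)) / (real (nv G) - real (nv ?H)) \<in> ?B"
    using H s by fastforce
  have "alpha G \<in> ?B" unfolding alpha_def using fB inB by (intro Min_in) auto
  then obtain H where H': "H \<in> proper_subgraphs G"
    "alpha G = (real (ne G) - real (ne H)) / (real (nv G) - real (nv H))" by auto
  then have "ne H \<le> ne G" "nv H \<le> nv G" using simple_graph_finite[OF G]
    by (auto simp: proper_subgraphs_def subgraph_def intro!: card_mono)
  then have a0: "0 \<le> alpha G" unfolding H'(2) by simp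
  have "alpha G \<le> (real (ne G) - real (ne ?H)) / (real (nv G) - real (nv ?H))"
    unfolding alpha_def using fB inB by (intro Min_le) auto
  then have "(real (nv G) - real (card (\<Union>F))) * alpha G \<le> real (ne G) - real (card F)"
    using s by (simp add: pos_le_divide_eq mult.commute)
  moreover have "(real (nv G) - real s) * alpha G \<le> (real (nv G) - real (card (\<Union>F))) * alpha G"
    using a0 s by (intro mult_right_mono) auto
  ultimately show ?thesis using 1 by (simp add: kappa_def)
qed

text \<open>If \<open>F\<close> is empty, the bound for a single edge applies, as it is even stronger and an edge fits
  into \<open>s \<ge> 2\<close> vertices.\<close>
lemma kappa_le:
  assumes G: "simple_graph G" and e: "edges G \<noteq> {}" and F: "F \<subseteq> edges G"
    and s: "card (\<Union>F) \<le> s" "2 \<le> s" "s < nv G"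
  shows "kappa G s \<le> real (ne G) - real (card F)"
proof (cases "F = {}")
  case True
  obtain e where e: "e \<in> edges G" "card e = 2" using e G by (auto simp: simple_graph_def all_pairs_def)
  then have "kappa G s \<le> real (ne G) - real (card {e})"
    using s by (intro kappa_le_nonempty[OF G]) auto
  then show ?thesis using True by simp
qed (use kappa_le_nonempty[OF G F _ s(1,3)] in auto)

text \<open>The common edges of two copies are pulled back along an isomorphism from \<open>G\<close> to the first
  copy; the pulled back edges span at most as many vertices as the two copies share.\<close>
lemma kappa_le_overlap:
  assumes G: "simple_graph G" and e: "edges G \<noteq> {}"
    and S: "finite S" "card S = nv G" "G' \<in> copies_on G S"
    and T: "finite T" "card T = nv G" "G'' \<in> copies_on G T"
    and s: "2 \<le> card (S \<inter> T)" "card (S \<inter> T) < nv G"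
  shows "kappa G (card (S \<inter> T)) \<le> real (card (edges G'' - edges G'))"
proof -
  obtain f where f: "bij_betw f (verts G) S" "(\<lambda>e. f ` e) ` edges G = edges G'"
    using copies_onD(4)[OF G S] by blast
  have EV: "edges G \<subseteq> Pow (verts G)" using G by (auto simp: simple_graph_def all_pairs_def)
  have inj: "inj_on (\<lambda>e. f ` e) (edges G)"
    using f(1) EV by (intro inj_on_subset[OF inj_on_image_Pow]) (auto simp: bij_betw_def)
  define F where "F = {e \<in> edges G. f ` e \<in> edges G''}"
  have F: "F \<subseteq> edges G" by (auto simp: F_def)
  have "(\<lambda>e. f ` e) ` F = edges G' \<inter> edges G''" unfolding f(2)[symmetric] F_def by auto
  moreover have "inj_on (\<lambda>e. f ` e) F" using inj F inj_on_subset by blast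
  ultimately have cF: "card F = card (edges G' \<inter> edges G'')" using card_image by metis
  have "f ` \<Union>F \<subseteq> S \<inter> T"
  proof -
    have "f ` e \<in> edges G' \<and> f ` e \<in> edges G''" if "e \<in> F" for e
      using that unfolding F_def f(2)[symmetric] by blast
    then have "f ` e \<subseteq> S \<inter> T" if "e \<in> F" for e
      using that copies_onD(2)[OF G S] copies_onD(2)[OF G T] unfolding all_pairs_def by blast
    then show ?thesis by blast
  qed
  moreover have "inj_on f (\<Union>F)"
  proof (rule inj_on_subset)
    show "inj_on f (verts G)" using f(1) by (simp add: bij_betw_def)
    show "\<Union>F \<subseteq> verts G" using F EV by blast
  qed
  ultimately have "card (\<Union>F) \<le> card (S \<inter> T)"
    using S(1) card_mono[of "S \<inter> T" "f ` \<Union>F"] by (simp only: card_image finite_Int simp_thms)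
  from kappa_le[OF G e F this s]
  have "kappa G (card (S \<inter> T)) \<le> real (ne G) - real (card F)" .
  also have "\<dots> = real (card (edges G'' - edges G'))"
  proof -
    have fin: "finite (edges G'')" using copies_onD(2)[OF G T] T(1) finite_all_pairs finite_subset by blast
    have "card (edges G'') = card (edges G'' \<inter> edges G') + card (edges G'' - edges G')"
      using card_Int_Diff[OF fin] by simp
    then show ?thesis using copies_onD(3)[OF G T] cF by (simp add: Int_commute)
  qed
  finally show ?thesis .
qed

section \<open>Numbers of overlapping vertex sets\<close>

lemma binomial_le_pow_div_fact: "real (n choose k) \<le> real n ^ k / fact k"
proof -
  have "real ((n choose k) * fact k) \<le> real (n ^ k)"
    using binomial_fact_pow[of n k] by (simp only: of_nat_le_iff)
  then show ?thesis by (simp add: pos_le_divide_eq)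
qed

text \<open>A set \<open>T\<close> is determined by \<open>S \<inter> T\<close> and \<open>T - S\<close>.\<close>
lemma card_subsets_overlap_le:
  assumes S: "S \<subseteq> {1..n}" "card S = v" and s: "s \<le> v"
  shows "real (card {T. T \<subseteq> {1..n} \<and> card T = v \<and> card (S \<inter> T) = s})
     \<le> real (v choose s) * (real n ^ (v - s) / fact (v - s))"
proof -
  let ?A = "{T. T \<subseteq> {1..n} \<and> card T = v \<and> card (S \<inter> T) = s}"
  let ?B = "{X. X \<subseteq> S \<and> card X = s} \<times> {Y. Y \<subseteq> {1..n} \<and> card Y = v - s}"
  have fS: "finite S" using S finite_subset by blast
  have "card ?A \<le> card ?B"
  proof (rule card_inj_on_le[where f = "\<lambda>T. (S \<inter> T, T - S)"])
    show "inj_on (\<lambda>T. (S \<inter> T, T - S)) ?A" by (rule inj_onI) auto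
    show "(\<lambda>T. (S \<inter> T, T - S)) ` ?A \<subseteq> ?B"
    proof
      fix x assume "x \<in> (\<lambda>T. (S \<inter> T, T - S)) ` ?A"
      then obtain T where T: "T \<subseteq> {1..n}" "card T = v" "card (S \<inter> T) = s" "x = (S \<inter> T, T - S)" by auto
      then have "finite T" using finite_subset by blast
      then have "card (T - S) = v - s" using T by (simp add: card_Diff_subset_Int Int_commute)
      then show "x \<in> ?B" using T by auto
    qed
    show "finite ?B" using fS by (intro finite_cartesian_product) auto
  qed
  also have "\<dots> = (v choose s) * (n choose (v - s))"
    using fS S by (simp add: card_cartesian_product n_subsets)
  finally have "real (card ?A) \<le> real (v choose s) * real (n choose (v - s))"
    by (simp only: of_nat_mult[symmetric] of_nat_le_iff)
  also have "\<dots> \<le> real (v choose s) * (real n ^ (v - s) / fact (v - s))"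
    by (intro mult_left_mono binomial_le_pow_div_fact) auto
  finally show ?thesis .
qed

text \<open>A set meeting \<open>S\<close> arises by adding a vertex of \<open>S\<close> to a set with one element fewer.\<close>
lemma card_subsets_meeting_le:
  assumes S: "S \<subseteq> {1..n}" "card S = v"
  shows "real (card {T. T \<subseteq> {1..n} \<and> card T = v \<and> S \<inter> T \<noteq> {}})
     \<le> real v ^ 2 / fact v * real n ^ (v - 1)"
proof -
  let ?A = "{T. T \<subseteq> {1..n} \<and> card T = v \<and> S \<inter> T \<noteq> {}}"
  let ?B = "S \<times> {Y. Y \<subseteq> {1..n} \<and> card Y = v - 1}"
  have fS: "finite S" using S finite_subset by blast
  have "?A \<subseteq> (\<lambda>(x, Y). insert x Y) ` ?B"
  proof
    fix T assume T: "T \<in> ?A"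
    then obtain x where x: "x \<in> S" "x \<in> T" by auto
    have "finite T" using T finite_subset by blast
    then have "T = (\<lambda>(x, Y). insert x Y) (x, T - {x})" "(x, T - {x}) \<in> ?B" using T x by auto
    then show "T \<in> (\<lambda>(x, Y). insert x Y) ` ?B" by (rule image_eqI)
  qed
  moreover have fB: "finite ?B" using fS by (intro finite_cartesian_product) auto
  ultimately have "card ?A \<le> card ?B" by (meson card_image_le card_mono finite_imageI le_trans)
  also have "\<dots> = v * (n choose (v - 1))" 
    using S by (simp add: card_cartesian_product n_subsets)
  finally have "real (card ?A) \<le> real v * real (n choose (v - 1))"
    by (simp only: of_nat_mult[symmetric] of_nat_le_iff)
  also have "\<dots> \<le> real v * (real n ^ (v - 1) / fact (v - 1))"
    by (intro mult_left_mono binomial_le_pow_div_fact) auto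
  also have "\<dots> = real v ^ 2 / fact v * real n ^ (v - 1)"
    by (cases v) (simp_all add: power2_eq_square divide_simps)
  finally show ?thesis .
qed

section \<open>Edge probabilities in the graphon random graph\<close>

lemma PiM_uniform_measure_Icc:
  assumes "finite I"
  shows "(\<Pi>\<^sub>M i\<in>I. uniform_measure lborel {0..1::real})
     = density (\<Pi>\<^sub>M i\<in>I. lborel) (indicator (\<Pi>\<^sub>E i\<in>I. {0..1}))"
proof -
  interpret lb: product_sigma_finite "\<lambda>_ :: 'a. lborel :: real measure"
    by unfold_locales
  have ps: "prob_space (uniform_measure lborel {0..1::real})"
    by (intro prob_space_uniform_measure) auto
  interpret un: product_prob_space "\<lambda>_ :: 'a. uniform_measure lborel {0..1::real}"
    by (rule product_prob_spaceI) (rule ps)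
  show ?thesis
  proof (rule un.PiM_eqI[symmetric])
    show "finite I" by fact
    show "sets (density (\<Pi>\<^sub>M i\<in>I. lborel) (indicator (\<Pi>\<^sub>E i\<in>I. {0..1::real})))
        = sets (\<Pi>\<^sub>M i\<in>I. uniform_measure lborel {0..1::real})"
      by (simp cong: sets_PiM_cong)
    fix A :: "'a \<Rightarrow> real set"
    assume "\<And>i. i \<in> I \<Longrightarrow> A i \<in> sets (uniform_measure lborel {0..1::real})"
    then have A: "A i \<in> sets lborel" if "i \<in> I" for i using that by auto
    have P: "(\<Pi>\<^sub>E i\<in>I. {0..1::real}) \<in> sets (\<Pi>\<^sub>M i\<in>I. lborel)"
      using assms by (intro sets_PiM_I_finite) auto
    have PA: "(\<Pi>\<^sub>E i\<in>I. A i) \<in> sets (\<Pi>\<^sub>M i\<in>I. lborel)"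
      using assms A by (intro sets_PiM_I_finite) auto
    have "emeasure (density (\<Pi>\<^sub>M i\<in>I. lborel) (indicator (\<Pi>\<^sub>E i\<in>I. {0..1::real}))) (Pi\<^sub>E I A)
        = (\<integral>\<^sup>+x. indicator ((\<Pi>\<^sub>E i\<in>I. {0..1::real}) \<inter> Pi\<^sub>E I A) x \<partial>(\<Pi>\<^sub>M i\<in>I. lborel))"
      using P PA by (simp add: emeasure_density indicator_inter_arith)
    also have "\<dots> = emeasure (\<Pi>\<^sub>M i\<in>I. lborel) (\<Pi>\<^sub>E i\<in>I. {0..1} \<inter> A i)"
      using sets.Int[OF P PA] by (simp add: PiE_Int)
    also have "\<dots> = (\<Prod>i\<in>I. emeasure lborel ({0..1} \<inter> A i))"
      using A assms by (intro lb.emeasure_PiM) auto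
    also have "\<dots> = (\<Prod>i\<in>I. emeasure (uniform_measure lborel {0..1}) (A i))"
      using A by (intro prod.cong) (auto simp: emeasure_uniform_measure divide_ennreal_def)
    finally show "emeasure (density (\<Pi>\<^sub>M i\<in>I. lborel) (indicator (\<Pi>\<^sub>E i\<in>I. {0..1::real}))) (Pi\<^sub>E I A)
        = (\<Prod>i\<in>I. emeasure (uniform_measure lborel {0..1}) (A i))" .
  qed
qed

locale graphon_graph = prob_space M for M :: "'w measure" +
  fixes n :: nat and h :: "real \<Rightarrow> real \<Rightarrow> real" and U :: "nat \<Rightarrow> 'w \<Rightarrow> real"
    and K :: "'w \<Rightarrow> nat graph"
  assumes graphon: "graphon h" and random_graph: "graphon_random_graph M n h U K"
begin

text \<open>Setting the graphon to zero outside the unit square makes it bounded, symmetric and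
  measurable everywhere. This changes nothing almost surely.\<close>
definition h0 :: "real \<Rightarrow> real \<Rightarrow> real" where
  "h0 x y = indicator ({0..1} \<times> {0..1}) (x, y) * h x y"

text \<open>The minimum and the maximum merely pick the two end points of an edge in a definite
  order.\<close>
definition weight :: "(nat \<Rightarrow> real) \<Rightarrow> nat set \<Rightarrow> real" where
  "weight w e = h0 (w (Min e)) (w (Max e))"

definition contains :: "nat set set \<Rightarrow> 'w set" where
  "contains F = {\<omega> \<in> space M. F \<subseteq> edges (K \<omega>)}"

lemma graphon_sup_ge:
  assumes "x \<in> {0..1}" "y \<in> {0..1}"
  shows "h x y \<le> graphon_sup h"
proof -
  have "h x y = (\<lambda>(x, y). h x y) (x, y)" by simp
  also have "\<dots> \<le> graphon_sup h"
    unfolding graphon_sup_def using assms graphon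
    by (intro cSUP_upper) (auto simp: graphon_def bdd_above_def)
  finally show ?thesis .
qed

lemma graphon_sup_bounds: "0 \<le> graphon_sup h" "graphon_sup h \<le> 1"
proof -
  show "0 \<le> graphon_sup h"
  proof (rule order_trans)
    show "0 \<le> h 0 0" using graphon by (simp add: graphon_def)
    show "h 0 0 \<le> graphon_sup h" by (rule graphon_sup_ge) auto
  qed
  show "graphon_sup h \<le> 1"
    unfolding graphon_sup_def using graphon by (intro cSUP_least) (auto simp: graphon_def)
qed

lemma h0_bounds: "0 \<le> h0 x y" "h0 x y \<le> 1" "h0 x y \<le> graphon_sup h"
  using graphon graphon_sup_ge graphon_sup_bounds by (auto simp: h0_def indicator_def graphon_def)

lemma h0_commute: "h0 x y = h0 y x"
  using graphon by (auto simp: h0_def indicator_def graphon_def)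

lemma h0_measurable [measurable]: "(\<lambda>(x, y). h0 x y) \<in> borel_measurable (borel \<Otimes>\<^sub>M borel)"
proof -
  have "(\<lambda>z. indicator ({0..1} \<times> {0..1}) z *\<^sub>R (\<lambda>(x, y). h x y) z) \<in> borel_measurable borel"
    using graphon unfolding graphon_def
    by (subst borel_measurable_restrict_space_iff[symmetric])
       (auto intro!: borel_closed closed_Times)
  also have "(\<lambda>z. indicator ({0..1} \<times> {0..1}) z *\<^sub>R (\<lambda>(x, y). h x y) z) = (\<lambda>(x, y). h0 x y)"
    by (auto simp: h0_def fun_eq_iff)
  finally show ?thesis by (simp add: borel_prod)
qed

lemma weight_bounds: "0 \<le> weight w e" "weight w e \<le> 1" "weight w e \<le> graphon_sup h"
  using h0_bounds by (auto simp: weight_def)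

lemma weight_pair: "weight w {u, v} = h0 (w u) (w v)"
  by (cases "u \<le> v") (auto simp: weight_def h0_commute max_def min_def)

lemma all_pairsE:
  assumes "e \<in> all_pairs S"
  obtains u v where "e = {u, v}" "u \<noteq> v" "u \<in> S" "v \<in> S"
  using assms by (auto simp: all_pairs_def card_2_iff)

lemma weight_measurable:
  assumes "e \<in> all_pairs S"
  shows "(\<lambda>w. weight w e) \<in> borel_measurable (\<Pi>\<^sub>M i\<in>S. borel)"
proof -
  obtain u v where e: "e = {u, v}" "u \<in> S" "v \<in> S" using assms by (rule all_pairsE)
  have "(\<lambda>w. (\<lambda>(x, y). h0 x y) (w u, w v)) \<in> borel_measurable (\<Pi>\<^sub>M i\<in>S. borel)"
    using e by measurable
  then show ?thesis by (simp add: e weight_pair)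
qed

lemma weight_cong:
  assumes "e \<in> all_pairs S" "\<And>i. i \<in> S \<Longrightarrow> w i = w' i"
  shows "weight w e = weight w' e"
  using assms by (auto elim!: all_pairsE simp: weight_pair)

lemma prod_weight_bounds:
  "0 \<le> (\<Prod>e\<in>F. weight w e)" "(\<Prod>e\<in>F. weight w e) \<le> 1"
  "(\<Prod>e\<in>F. weight w e) \<le> graphon_sup h ^ card F"
proof -
  show "0 \<le> (\<Prod>e\<in>F. weight w e)" by (intro prod_nonneg) (auto simp: weight_bounds)
  show "(\<Prod>e\<in>F. weight w e) \<le> 1" by (intro prod_le_1) (auto simp: weight_bounds)
  show "(\<Prod>e\<in>F. weight w e) \<le> graphon_sup h ^ card F"
    using prod_mono[of F "weight w" "\<lambda>_. graphon_sup h"] by (simp add: weight_bounds)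
qed

lemma indep_U: "indep_vars (\<lambda>_. borel) U {1..n}"
  using random_graph by (simp add: graphon_random_graph_def)

lemma U_measurable: "i \<in> {1..n} \<Longrightarrow> U i \<in> borel_measurable M"
  using indep_U by (auto simp: indep_vars_def)

lemma distr_U: "i \<in> {1..n} \<Longrightarrow> distr M borel (U i) = uniform_measure lborel {0..1}"
  using random_graph by (simp add: graphon_random_graph_def)

lemma U_in_unit: "AE \<omega> in M. \<forall>i\<in>{1..n}. U i \<omega> \<in> {0..1}"
proof (intro AE_finite_allI)
  fix i assume i: "i \<in> {1..n}"
  have "AE x in distr M borel (U i). x \<in> {0..1}"
    unfolding distr_U[OF i] by (rule AE_uniform_measureI) auto
  then show "AE \<omega> in M. U i \<omega> \<in> {0..1}"
    using U_measurable[OF i] by (rule AE_distrD[rotated])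
qed simp

lemma finite_pairs: "F \<subseteq> all_pairs {1..n} \<Longrightarrow> finite F"
  using finite_subset finite_all_pairs[of "{1..n}"] by blast

lemma prod_weight_measurable:
  assumes "F \<subseteq> all_pairs S"
  shows "(\<lambda>w. \<Prod>e\<in>F. weight w e) \<in> borel_measurable (\<Pi>\<^sub>M i\<in>S. borel)"
  using assms by (intro borel_measurable_prod weight_measurable) auto

lemma U_vector_measurable:
  assumes "S \<subseteq> {1..n}"
  shows "(\<lambda>\<omega>. \<lambda>i\<in>S. U i \<omega>) \<in> measurable M (\<Pi>\<^sub>M i\<in>S. borel)"
  using assms by (intro measurable_restrict U_measurable) auto

lemma prod_weight_restrict:
  assumes "F \<subseteq> all_pairs S"
  shows "(\<Prod>e\<in>F. weight (\<lambda>i\<in>S. w i) e) = (\<Prod>e\<in>F. weight w e)"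
  using assms by (intro prod.cong refl weight_cong[of _ S]) auto

lemma integrable_prod_weight:
  assumes "F \<subseteq> all_pairs {1..n}"
  shows "integrable M (\<lambda>\<omega>. \<Prod>e\<in>F. weight (\<lambda>i. U i \<omega>) e)"
proof (rule integrable_const_bound[where B = 1])
  have "(\<lambda>\<omega>. \<Prod>e\<in>F. weight (\<lambda>i\<in>{1..n}. U i \<omega>) e) \<in> borel_measurable M"
    using measurable_compose[OF U_vector_measurable prod_weight_measurable[OF assms]] by simp
  then show "(\<lambda>\<omega>. \<Prod>e\<in>F. weight (\<lambda>i. U i \<omega>) e) \<in> borel_measurable M"
    by (simp only: prod_weight_restrict[OF assms])
qed (auto simp: prod_weight_bounds)

lemma contains_eq_INT:
  "contains F = space M \<inter> (\<Inter>e\<in>F. edge_event M K e)"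
  by (auto simp: contains_def edge_event_def)

lemma contains_events:
  assumes "F \<subseteq> all_pairs {1..n}"
  shows "contains F \<in> events"
proof (cases "F = {}")
  case False
  then show ?thesis unfolding contains_eq_INT using assms random_graph finite_pairs[OF assms]
    by (intro sets.Int sets.finite_INT) (auto simp: graphon_random_graph_def)
qed (simp add: contains_def)

text \<open>This lemma carries all the information about the random graph that the proof needs:
  integrating the conditional independence of the edges turns edge probabilities into
  expectations of products over the independent variables \<open>U\<close>.\<close>
lemma prob_contains:
  assumes F: "F \<subseteq> all_pairs {1..n}"
  shows "prob (contains F) = expectation (\<lambda>\<omega>. \<Prod>e\<in>F. weight (\<lambda>i. U i \<omega>) e)"
proof -
  let ?\<F> = "sigma_of M n U"
  interpret sub: finite_measure_subalgebra M ?\<F>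
  proof (unfold_locales)
    have "sets ?\<F> \<subseteq> sets M"
      unfolding sigma_of_def using U_vector_measurable[of "{1..n}"]
      by (intro sets_image_in_sets) auto
    then show "subalgebra M ?\<F>" by (simp add: subalgebra_def sigma_of_def)
  qed
  have "AE \<omega> in M. cond_prob_on M ?\<F> (contains F) \<omega> = (\<Prod>e\<in>F. cond_prob_on M ?\<F> (edge_event M K e) \<omega>)"
    using random_graph F finite_pairs[OF F] unfolding contains_eq_INT
    by (auto simp: graphon_random_graph_def cond_indep_events_def)
  moreover have "AE \<omega> in M. \<forall>e\<in>F. cond_prob_on M ?\<F> (edge_event M K e) \<omega> = weight (\<lambda>i. U i \<omega>) e"
  proof (rule AE_finite_allI[OF finite_pairs[OF F]])
    fix e assume "e \<in> F"
    then obtain u v where e: "e = {u, v}" "u \<noteq> v" "u \<in> {1..n}" "v \<in> {1..n}"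
      using F all_pairsE by blast
    then have "AE \<omega> in M. cond_prob_on M ?\<F> (edge_event M K e) \<omega> = h (U u \<omega>) (U v \<omega>)"
      using random_graph by (simp add: graphon_random_graph_def)
    with U_in_unit show "AE \<omega> in M. cond_prob_on M ?\<F> (edge_event M K e) \<omega> = weight (\<lambda>i. U i \<omega>) e"
      by eventually_elim (use e in \<open>simp add: weight_pair h0_def\<close>)
  qed
  ultimately have ae: "AE \<omega> in M. real_cond_exp M ?\<F> (indicator (contains F)) \<omega>
      = (\<Prod>e\<in>F. weight (\<lambda>i. U i \<omega>) e)"
    by eventually_elim (simp add: cond_prob_on_def)
  have ind: "integrable M (indicator (contains F) :: 'w \<Rightarrow> real)"
    using contains_events[OF F] by (intro integrable_real_indicator) (auto simp: emeasure_eq_measure)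
  have "prob (contains F) = expectation (indicator (contains F))"
    using contains_events[OF F] by simp
  also have "\<dots> = expectation (real_cond_exp M ?\<F> (indicator (contains F)))"
    using sub.real_cond_exp_int(2)[OF ind] by simp
  also have "\<dots> = expectation (\<lambda>\<omega>. \<Prod>e\<in>F. weight (\<lambda>i. U i \<omega>) e)"
  proof (rule integral_cong_AE[OF _ _ ae])
    show "real_cond_exp M ?\<F> (indicator (contains F)) \<in> borel_measurable M"
      using sub.real_cond_exp_int(1)[OF ind] by auto
    show "(\<lambda>\<omega>. \<Prod>e\<in>F. weight (\<lambda>i. U i \<omega>) e) \<in> borel_measurable M"
      using integrable_prod_weight[OF F] by auto
  qed
  finally show ?thesis .
qed

text \<open>Edge sets on disjoint vertex sets involve disjoint families of the variables \<open>U\<close>. Edge sets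
  that share only a vertex are in general dependent, which is why the neighbourhoods below are defined by
  common vertices and not by common edges.\<close>
lemma prob_contains_disjoint:
  assumes "F \<subseteq> all_pairs S" "F' \<subseteq> all_pairs T" "S \<subseteq> {1..n}" "T \<subseteq> {1..n}" "S \<inter> T = {}"
  shows "prob (contains (F \<union> F')) = prob (contains F) * prob (contains F')"
proof -
  have F: "F \<subseteq> all_pairs {1..n}" and F': "F' \<subseteq> all_pairs {1..n}"
    using assms all_pairs_mono by blast+
  have disj: "F \<inter> F' = {}"
  proof (rule ccontr)
    assume "F \<inter> F' \<noteq> {}"
    then obtain e where "e \<in> F" "e \<in> F'" by auto
    then have "e \<subseteq> S \<inter> T" "card e = 2" using assms(1,2) by (auto simp: all_pairs_def)
    then show False using assms(5) by auto
  qed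
  have ind: "indep_var borel ((\<lambda>w. \<Prod>e\<in>F. weight w e) \<circ> (\<lambda>\<omega>. \<lambda>i\<in>S. U i \<omega>))
      borel ((\<lambda>w. \<Prod>e\<in>F'. weight w e) \<circ> (\<lambda>\<omega>. \<lambda>i\<in>T. U i \<omega>))"
    using indep_U assms prod_weight_measurable
    by (intro indep_var_compose[OF indep_var_restrict]) auto
  have comp: "(\<lambda>w. \<Prod>e\<in>F. weight w e) \<circ> (\<lambda>\<omega>. \<lambda>i\<in>S. U i \<omega>) = (\<lambda>\<omega>. \<Prod>e\<in>F. weight (\<lambda>i. U i \<omega>) e)"
    "(\<lambda>w. \<Prod>e\<in>F'. weight w e) \<circ> (\<lambda>\<omega>. \<lambda>i\<in>T. U i \<omega>) = (\<lambda>\<omega>. \<Prod>e\<in>F'. weight (\<lambda>i. U i \<omega>) e)"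
    by (simp_all only: o_def prod_weight_restrict assms)
  have "prob (contains (F \<union> F')) = expectation (\<lambda>\<omega>. (\<Prod>e\<in>F. weight (\<lambda>i. U i \<omega>) e) * (\<Prod>e\<in>F'. weight (\<lambda>i. U i \<omega>) e))"
    using F F' finite_pairs disj by (subst prob_contains) (auto simp: prod.union_disjoint)
  also have "\<dots> = prob (contains F) * prob (contains F')"
    unfolding prob_contains[OF F] prob_contains[OF F']
    using ind unfolding comp
    by (rule indep_var_lebesgue_integral) (intro integrable_prod_weight F F')+
  finally show ?thesis .
qed

text \<open>In the expectation of the product of weights, each new edge contributes a factor at most
  \<open>graphon_sup h\<close>.\<close>
lemma prob_contains_Un_le:
  assumes F: "F \<subseteq> all_pairs {1..n}" and F': "F' \<subseteq> all_pairs {1..n}"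
  shows "prob (contains (F \<union> F')) \<le> prob (contains F) * graphon_sup h ^ card (F' - F)"
proof -
  have FF': "F \<union> F' \<subseteq> all_pairs {1..n}" using F F' by auto
  have "prob (contains (F \<union> F'))
      \<le> expectation (\<lambda>\<omega>. (\<Prod>e\<in>F. weight (\<lambda>i. U i \<omega>) e) * graphon_sup h ^ card (F' - F))"
    unfolding prob_contains[OF FF']
  proof (rule integral_mono)
    show "integrable M (\<lambda>\<omega>. \<Prod>e\<in>F \<union> F'. weight (\<lambda>i. U i \<omega>) e)"
      by (rule integrable_prod_weight[OF FF'])
    show "integrable M (\<lambda>\<omega>. (\<Prod>e\<in>F. weight (\<lambda>i. U i \<omega>) e) * graphon_sup h ^ card (F' - F))"
      using integrable_prod_weight[OF F] by simp
    fix \<omega>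
    have "(\<Prod>e\<in>F \<union> F'. weight (\<lambda>i. U i \<omega>) e)
        = (\<Prod>e\<in>F. weight (\<lambda>i. U i \<omega>) e) * (\<Prod>e\<in>F' - F. weight (\<lambda>i. U i \<omega>) e)"
      using finite_pairs[OF F] finite_pairs[OF F']
      by (subst prod.union_disjoint[symmetric]) (auto intro!: prod.cong)
    also have "\<dots> \<le> (\<Prod>e\<in>F. weight (\<lambda>i. U i \<omega>) e) * graphon_sup h ^ card (F' - F)"
      by (intro mult_left_mono prod_weight_bounds)
    finally show "(\<Prod>e\<in>F \<union> F'. weight (\<lambda>i. U i \<omega>) e)
        \<le> (\<Prod>e\<in>F. weight (\<lambda>i. U i \<omega>) e) * graphon_sup h ^ card (F' - F)" .
  qed
  then show ?thesis by (simp add: prob_contains[OF F])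
qed

lemma distr_U_reindex:
  assumes f: "inj_on f I" "f ` I \<subseteq> {1..n}" and I: "I \<noteq> {}"
  shows "distr M (\<Pi>\<^sub>M i\<in>I. borel) (\<lambda>\<omega>. \<lambda>i\<in>I. U (f i) \<omega>)
     = (\<Pi>\<^sub>M i\<in>I. uniform_measure lborel {0..1})"
proof -
  let ?u = "uniform_measure lborel {0..1::real}"
  have ps: "prob_space ?u" by (intro prob_space_uniform_measure) auto
  have ne: "{1..n} \<noteq> {}" using f I by blast
  have sets_u: "sets (\<Pi>\<^sub>M i\<in>J. ?u) = sets (\<Pi>\<^sub>M i\<in>J. borel)" for J :: "'c set"
    by (intro sets_PiM_cong) auto
  have "distr M (\<Pi>\<^sub>M i\<in>{1..n}. borel) (\<lambda>\<omega>. \<lambda>i\<in>{1..n}. U i \<omega>)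
      = (\<Pi>\<^sub>M i\<in>{1..n}. distr M borel (U i))"
    using indep_vars_iff_distr_eq_PiM'[where I = "{1..n}" and M' = "\<lambda>_. borel" and X = U, OF ne U_measurable] indep_U
    by blast
  also have "\<dots> = (\<Pi>\<^sub>M i\<in>{1..n}. ?u)"
    by (intro PiM_cong refl distr_U)
  finally have U: "distr M (\<Pi>\<^sub>M i\<in>{1..n}. borel) (\<lambda>\<omega>. \<lambda>i\<in>{1..n}. U i \<omega>) = (\<Pi>\<^sub>M i\<in>{1..n}. ?u)" .
  let ?t = "\<lambda>w. \<lambda>i\<in>I. w (f i)"
  have t: "?t \<in> measurable (\<Pi>\<^sub>M i\<in>{1..n}. borel) (\<Pi>\<^sub>M i\<in>I. borel)"
    using f by (intro measurable_restrict measurable_component_singleton) auto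
  have "distr M (\<Pi>\<^sub>M i\<in>I. borel) (\<lambda>\<omega>. \<lambda>i\<in>I. U (f i) \<omega>)
      = distr (distr M (\<Pi>\<^sub>M i\<in>{1..n}. borel) (\<lambda>\<omega>. \<lambda>i\<in>{1..n}. U i \<omega>)) (\<Pi>\<^sub>M i\<in>I. borel) ?t"
  proof (subst distr_distr[OF t U_vector_measurable[OF order_refl]], intro distr_cong refl)
    fix \<omega>
    show "(\<lambda>i\<in>I. U (f i) \<omega>) = (?t \<circ> (\<lambda>\<omega>. \<lambda>i\<in>{1..n}. U i \<omega>)) \<omega>"
      unfolding o_def
    proof (rule restrict_ext)
      fix i assume "i \<in> I"
      then have "f i \<in> {1..n}" using f(2) by blast
      then show "U (f i) \<omega> = (\<lambda>i\<in>{1..n}. U i \<omega>) (f i)" by (rule restrict_apply'[symmetric])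
    qed
  qed
  also have "\<dots> = distr (\<Pi>\<^sub>M i\<in>{1..n}. ?u) (\<Pi>\<^sub>M i\<in>I. ?u) ?t"
    unfolding U by (intro distr_cong refl) (simp add: sets_u)
  also have "\<dots> = (\<Pi>\<^sub>M i\<in>I. ?u)"
    using distr_PiM_reindex[of "{1..n}" "\<lambda>_. ?u" f I] f ps by auto
  finally show ?thesis .
qed

lemma mu_eq_integral_weight:
  assumes G: "simple_graph G" "verts G = {1..nv G}"
  shows "mu h G = (\<integral>w. (\<Prod>e\<in>edges G. weight w e) \<partial>(\<Pi>\<^sub>M i\<in>{1..nv G}. uniform_measure lborel {0..1}))"
proof -
  let ?V = "{1..nv G}" and ?P = "{(i, j). 1 \<le> i \<and> i < j \<and> j \<le> nv G \<and> {i, j} \<in> edges G}"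
  have E: "edges G \<subseteq> all_pairs ?V" using G by (simp add: simple_graph_def)
  have prod: "(\<Prod>e\<in>edges G. weight w e) = (\<Prod>(i, j)\<in>?P. h (w i) (w j))"
    if w: "\<And>i. i \<in> ?V \<Longrightarrow> w i \<in> {0..1}" for w
  proof -
    have "(\<Prod>(i, j)\<in>?P. h (w i) (w j)) = (\<Prod>p\<in>?P. weight w {fst p, snd p})"
      using w by (intro prod.cong) (auto simp: weight_pair h0_def)
    also have "\<dots> = (\<Prod>e\<in>(\<lambda>p. {fst p, snd p}) ` ?P. weight w e)"
      by (subst prod.reindex) (auto simp: inj_on_def doubleton_eq_iff)
    also have "(\<lambda>p. {fst p, snd p}) ` ?P = edges G"
    proof (intro equalityI subsetI)
      fix e assume e: "e \<in> edges G"
      then obtain u v where uv: "e = {u, v}" "u \<noteq> v" "u \<in> ?V" "v \<in> ?V" using E all_pairsE by blast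
      have "(min u v, max u v) \<in> ?P" "e = {min u v, max u v}"
        using uv e by (auto simp: min_def max_def insert_commute)
      then show "e \<in> (\<lambda>p. {fst p, snd p}) ` ?P"
        by (intro image_eqI[where x = "(min u v, max u v)"]) (simp_all only: fst_conv snd_conv)
    qed auto
    finally show ?thesis ..
  qed
  have "mu h G = (\<integral>w. indicator (\<Pi>\<^sub>E i\<in>?V. {0..1}) w *\<^sub>R (\<Prod>e\<in>edges G. weight w e) \<partial>(\<Pi>\<^sub>M i\<in>?V. lborel))"
    unfolding mu_def set_lebesgue_integral_def
  proof (intro Bochner_Integration.integral_cong refl)
    fix w :: "nat \<Rightarrow> real"
    show "indicator (\<Pi>\<^sub>E i\<in>?V. {0..1}) w *\<^sub>R (\<Prod>(i, j)\<in>?P. h (w i) (w j))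
        = indicator (\<Pi>\<^sub>E i\<in>?V. {0..1}) w *\<^sub>R (\<Prod>e\<in>edges G. weight w e)"
    proof (cases "w \<in> (\<Pi>\<^sub>E i\<in>?V. {0..1})")
      case True
      then have "w i \<in> {0..1}" if "i \<in> ?V" for i using that by (rule PiE_mem)
      from prod[OF this] show ?thesis by (simp only:)
    qed simp
  qed
  also have "\<dots> = (\<integral>w. (\<Prod>e\<in>edges G. weight w e) \<partial>density (\<Pi>\<^sub>M i\<in>?V. lborel)
      (\<lambda>w. ennreal (indicator (\<Pi>\<^sub>E i\<in>?V. {0..1}) w)))"
  proof (rule integral_density[symmetric])
    show "(\<lambda>w. \<Prod>e\<in>edges G. weight w e) \<in> borel_measurable (\<Pi>\<^sub>M i\<in>?V. lborel)"
      using prod_weight_measurable[OF E] by (simp cong: measurable_cong_sets sets_PiM_cong)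
    show "indicator (\<Pi>\<^sub>E i\<in>?V. {0..1}) \<in> borel_measurable (\<Pi>\<^sub>M i\<in>?V. lborel :: real measure)"
      by (intro borel_measurable_indicator sets_PiM_I_finite) auto
  qed auto
  also have "density (\<Pi>\<^sub>M i\<in>?V. lborel) (\<lambda>w. ennreal (indicator (\<Pi>\<^sub>E i\<in>?V. {0..1::real}) w))
      = (\<Pi>\<^sub>M i\<in>?V. uniform_measure lborel {0..1})"
    by (simp add: PiM_uniform_measure_Icc ennreal_indicator)
  finally show ?thesis .
qed

text \<open>Relabelling the vertices leaves the probability unchanged, because any selection of distinct
  \<open>U\<close> variables has the same joint law.\<close>
lemma prob_contains_copy:
  assumes G: "simple_graph G" "verts G = {1..nv G}" "verts G \<noteq> {}"
    and S: "S \<subseteq> {1..n}" "card S = nv G" and G': "G' \<in> copies_on G S"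
  shows "prob (contains (edges G')) = mu h G"
proof -
  let ?V = "{1..nv G}"
  have fS: "finite S" using S finite_subset by blast
  note copy = copies_onD[OF G(1) fS S(2) G']
  obtain f where f: "bij_betw f ?V S" "(\<lambda>e. f ` e) ` edges G = edges G'"
    using copy(4) G(2) by auto
  have E: "edges G \<subseteq> all_pairs ?V" using G by (simp add: simple_graph_def)
  have E': "edges G' \<subseteq> all_pairs {1..n}" using copy(2) S by (auto simp: all_pairs_def)
  have inj: "inj_on (\<lambda>e. f ` e) (edges G)"
    using f(1) E by (intro inj_on_subset[OF inj_on_image_Pow[of f ?V]])
      (auto simp: bij_betw_def all_pairs_def)
  have V: "?V \<noteq> {}" using G by simp
  have fV: "inj_on f ?V" "f ` ?V \<subseteq> {1..n}" using f(1) S by (auto simp: bij_betw_def)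
  have weight_image: "weight w (f ` e) = weight (\<lambda>i\<in>?V. w (f i)) e" if "e \<in> edges G" for w e
    using that E by (auto elim!: all_pairsE simp: weight_pair)
  have "prob (contains (edges G')) = expectation (\<lambda>\<omega>. \<Prod>e\<in>edges G'. weight (\<lambda>i. U i \<omega>) e)"
    by (rule prob_contains[OF E'])
  also have "\<dots> = expectation (\<lambda>\<omega>. \<Prod>e\<in>edges G. weight (\<lambda>i\<in>?V. U (f i) \<omega>) e)"
    unfolding f(2)[symmetric] using inj by (simp add: prod.reindex weight_image)
  also have "\<dots> = (\<integral>w. (\<Prod>e\<in>edges G. weight w e) \<partial>distr M (\<Pi>\<^sub>M i\<in>?V. borel) (\<lambda>\<omega>. \<lambda>i\<in>?V. U (f i) \<omega>))"
    by (intro integral_distr[symmetric] prod_weight_measurable[OF E] measurable_restrict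
        U_measurable) (use fV(2) in blast)
  also have "\<dots> = mu h G"
    unfolding distr_U_reindex[OF fV V] mu_eq_integral_weight[OF G(1,2)] ..
  finally show ?thesis .
qed

end

section \<open>Joint probabilities of overlapping copies\<close>

text \<open>A bound for the conditional probability of a second, different copy that shares \<open>s \<ge> 1\<close> vertices with a
  given one. With one common vertex all its edges are new. With all vertices common, two
  different copies still differ in at least one edge.\<close>
definition overlap_bound :: "'a graph \<Rightarrow> real \<Rightarrow> nat \<Rightarrow> real" where
  "overlap_bound G x s =
     (if s = 1 then x ^ ne G else if s < nv G then x powr kappa G s else x)"

text \<open>Grouping by the number of common vertices. For one common vertex the count of all sets that meet
  \<open>S\<close> is used, since its bound has the same form as the one for the products of the means.\<close>
lemma sum_overlap_bound_le:
  assumes S: "S \<subseteq> {1..n}" "card S = nv G" and v: "2 \<le> nv G" and x: "0 \<le> x"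
  shows "(\<Sum>T | T \<subseteq> {1..n} \<and> card T = nv G \<and> S \<inter> T \<noteq> {}. overlap_bound G x (card (S \<inter> T)))
    \<le> (real (nv G) ^ 2 / fact (nv G)) * real n ^ (nv G - 1) * x ^ ne G + x
       + (\<Sum>s = 2..nv G - 1.
            real (nv G choose s) * (real n ^ (nv G - s) * x powr kappa G s / fact (nv G - s)))"
proof -
  let ?v = "nv G"
  let ?\<T> = "{T. T \<subseteq> {1..n} \<and> card T = ?v \<and> S \<inter> T \<noteq> {}}"
  have fS: "finite S" using S finite_subset by blast
  have "finite (Pow {1..n})" by simp
  then have f\<T>: "finite ?\<T>" by (rule rev_finite_subset) auto
  have c: "real (card {T \<in> ?\<T>. card (S \<inter> T) = s}) \<le> real (?v choose s) * (real n ^ (?v - s) / fact (?v - s))"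
    if "s \<le> ?v" for s
  proof -
    have "card {T \<in> ?\<T>. card (S \<inter> T) = s} \<le> card {T. T \<subseteq> {1..n} \<and> card T = ?v \<and> card (S \<inter> T) = s}"
      using \<open>finite (Pow {1..n})\<close> by (intro card_mono) (auto elim!: rev_finite_subset)
    with card_subsets_overlap_le[OF S that] show ?thesis by linarith
  qed
  have c1: "real (card {T \<in> ?\<T>. card (S \<inter> T) = 1}) \<le> real ?v ^ 2 / fact ?v * real n ^ (?v - 1)"
  proof -
    have "card {T \<in> ?\<T>. card (S \<inter> T) = 1} \<le> card ?\<T>" using f\<T> by (intro card_mono) auto
    with card_subsets_meeting_le[OF S] show ?thesis by linarith
  qed
  have "(\<Sum>T\<in>?\<T>. overlap_bound G x (card (S \<inter> T)))
      = (\<Sum>s\<in>{1..?v}. \<Sum>T\<in>{T \<in> ?\<T>. card (S \<inter> T) = s}. overlap_bound G x (card (S \<inter> T)))"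
  proof (rule sum.group[symmetric, OF f\<T>])
    show "(\<lambda>T. card (S \<inter> T)) ` ?\<T> \<subseteq> {1..?v}"
    proof (intro subsetI, elim imageE)
      fix s T assume "s = card (S \<inter> T)" "T \<in> ?\<T>"
      then show "s \<in> {1..?v}"
        using fS S card_mono[of S "S \<inter> T"] by (auto simp: Suc_le_eq card_gt_0_iff)
    qed
  qed simp
  also have "\<dots> = (\<Sum>s\<in>{1..?v}. real (card {T \<in> ?\<T>. card (S \<inter> T) = s}) * overlap_bound G x s)"
    by (intro sum.cong refl) simp
  also have "{1..?v} = insert 1 (insert ?v {2..?v - 1})" using v by auto
  also have "(\<Sum>s\<in>\<dots>. real (card {T \<in> ?\<T>. card (S \<inter> T) = s}) * overlap_bound G x s)
      = real (card {T \<in> ?\<T>. card (S \<inter> T) = 1}) * x ^ ne G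
        + (real (card {T \<in> ?\<T>. card (S \<inter> T) = ?v}) * x
        + (\<Sum>s = 2..?v - 1. real (card {T \<in> ?\<T>. card (S \<inter> T) = s}) * x powr kappa G s))"
    using v by (subst sum.insert) (auto simp: overlap_bound_def intro!: sum.cong)
  also have "\<dots> \<le> (real ?v ^ 2 / fact ?v * real n ^ (?v - 1)) * x ^ ne G
        + (1 * x
        + (\<Sum>s = 2..?v - 1. (real (?v choose s) * (real n ^ (?v - s) / fact (?v - s))) * x powr kappa G s))"
    using c1 c[of ?v] x
    by (intro add_mono sum_mono mult_right_mono c) auto
  finally show ?thesis by (simp add: algebra_simps)
qed

context graphon_graph
begin

lemma prob_two_copies_le:
  assumes G: "simple_graph G" "verts G = {1..nv G}" "edges G \<noteq> {}"
    and S: "S \<subseteq> {1..n}" "card S = nv G" "G' \<in> copies_on G S"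
    and T: "T \<subseteq> {1..n}" "card T = nv G" "G'' \<in> copies_on G T"
    and meet: "S \<inter> T \<noteq> {}" and diff: "(S, G') \<noteq> (T, G'')"
    and pos: "0 < graphon_sup h"
  shows "prob (contains (edges G') \<inter> contains (edges G''))
     \<le> mu h G * overlap_bound G (graphon_sup h) (card (S \<inter> T))"
proof -
  let ?x = "graphon_sup h" and ?s = "card (S \<inter> T)" and ?k = "card (edges G'' - edges G')"
  have fS: "finite S" and fT: "finite T" using S T finite_subset by blast+
  note copS = copies_onD[OF G(1) fS S(2,3)] and copT = copies_onD[OF G(1) fT T(2,3)]
  have E: "edges G' \<subseteq> all_pairs {1..n}" "edges G'' \<subseteq> all_pairs {1..n}"
    using order_trans[OF copS(2) all_pairs_mono[OF S(1)]] order_trans[OF copT(2) all_pairs_mono[OF T(1)]]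
    by auto
  have V: "verts G \<noteq> {}" using G by (auto simp: simple_graph_def all_pairs_def)
  have m: "prob (contains (edges G')) = mu h G"
    by (rule prob_contains_copy[OF G(1,2) V S])
  have x1: "?x \<le> 1" by (rule graphon_sup_bounds)
  have sv: "?s \<le> nv G" using card_mono[of S "S \<inter> T"] fS S(2) by simp
  have "?x ^ ?k \<le> overlap_bound G ?x ?s"
  proof -
    consider "?s = 1" | "2 \<le> ?s" "?s < nv G" | "?s \<noteq> 1" "?s = nv G"
      using meet fS sv by (cases "?s = 0"; force)
    then show ?thesis
    proof cases
      case 1
      have "edges G'' \<inter> edges G' = {}"
      proof (rule ccontr)
        assume "edges G'' \<inter> edges G' \<noteq> {}"
        then obtain e where "e \<in> edges G'" "e \<in> edges G''" by blast
        then have "e \<subseteq> S \<inter> T" "card e = 2" using copS(2) copT(2) by (auto simp: all_pairs_def)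
        then show False using 1 card_mono[of "S \<inter> T" e] fS by simp
      qed
      then have "edges G'' - edges G' = edges G''" by blast
      then show ?thesis using 1 copT(3) by (simp add: overlap_bound_def)
    next
      case 2
      have "?x ^ ?k = ?x powr real ?k" using pos by (simp add: powr_realpow)
      also have "\<dots> \<le> ?x powr kappa G ?s"
        using kappa_le_overlap[OF G(1,3) fS S(2,3) fT T(2,3) 2] pos x1
        by (intro powr_mono') auto
      finally show ?thesis using 2 by (simp add: overlap_bound_def)
    next
      case 3
      have "S \<inter> T = S" using 3 S(2) fS by (intro card_subset_eq) auto
      moreover have "S \<inter> T = T" using 3 T(2) fT by (intro card_subset_eq) auto
      ultimately have "S = T" by simp
      then have "edges G' \<noteq> edges G''" using diff copS(1) copT(1) by (auto simp: prod_eq_iff)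
      moreover have fin: "finite (edges G')" "finite (edges G'')" using E finite_pairs by auto
      ultimately have "\<not> edges G'' \<subseteq> edges G'"
        using card_subset_eq[of "edges G'" "edges G''"] copS(3) copT(3) by auto
      then have "0 < ?k" using fin by (auto simp: card_gt_0_iff)
      then have "?x ^ ?k \<le> ?x ^ 1" using pos x1 by (intro power_decreasing) auto
      then show ?thesis using 3 by (simp add: overlap_bound_def)
    qed
  qed
  moreover have "contains (edges G') \<inter> contains (edges G'') = contains (edges G' \<union> edges G'')"
    by (auto simp: contains_def)
  moreover have "0 \<le> mu h G" using m[symmetric] by simp
  ultimately show ?thesis
    using prob_contains_Un_le[OF E] unfolding m by (auto intro: order_trans mult_left_mono)
qed

lemma mu_le:
  assumes G: "simple_graph G" "verts G = {1..nv G}" "verts G \<noteq> {}"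
    and S: "S \<subseteq> {1..n}" "card S = nv G" and G': "G' \<in> copies_on G S"
  shows "mu h G \<le> graphon_sup h ^ ne G"
proof -
  have "finite S" using S finite_subset by blast
  note copy = copies_onD[OF G(1) this S(2) G']
  have E: "edges G' \<subseteq> all_pairs {1..n}" using copy(2) S by (auto simp: all_pairs_def)
  have "contains {} = space M" by (simp add: contains_def)
  then show ?thesis
    using prob_contains_Un_le[of "{}" "edges G'"] E copy(3)
    by (simp add: prob_contains_copy[OF G S G'] prob_space)
qed

section \<open>Poisson approximation of the number of copies\<close>

text \<open>The index set of the Stein-Chen bound. A copy is paired with its vertex set to match the
  double sum that defines the number of copies.\<close>
definition placed_copies :: "nat graph \<Rightarrow> (nat set \<times> nat graph) set" where
  "placed_copies G = Sigma {S. S \<subseteq> {1..n} \<and> card S = nv G} (copies_on G)"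

definition meeting :: "nat graph \<Rightarrow> nat set \<times> nat graph \<Rightarrow> (nat set \<times> nat graph) set" where
  "meeting G i = Sigma {T. T \<subseteq> {1..n} \<and> card T = nv G \<and> fst i \<inter> T \<noteq> {}} (copies_on G)"

lemma finite_subsets_such_that: "finite {S. S \<subseteq> {1..n} \<and> P S}"
  by (rule finite_subset[of _ "Pow {1..n}"]) auto

lemma sum_copies_const:
  assumes G: "simple_graph G"
    and \<T>: "\<T> \<subseteq> {S. S \<subseteq> {1..n} \<and> card S = nv G}"
  shows "(\<Sum>i\<in>Sigma \<T> (copies_on G). f (fst i)) = rho G * (\<Sum>T\<in>\<T>. f T :: real)"
proof -
  have f\<T>: "finite \<T>" using \<T> finite_subsets_such_that by (rule finite_subset)
  have T: "finite T" "card T = nv G" if "T \<in> \<T>" for T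
    using that \<T> by (auto intro: finite_subset[OF _ finite_atLeastAtMost])
  have "(\<Sum>i\<in>Sigma \<T> (copies_on G). f (fst i)) = (\<Sum>T\<in>\<T>. \<Sum>G'\<in>copies_on G T. f T)"
    using f\<T> T by (subst sum.Sigma) (auto simp: finite_copies_on split_beta)
  also have "\<dots> = (\<Sum>T\<in>\<T>. rho G * f T)"
    using T by (intro sum.cong refl) (simp add: card_copies_on[OF G])
  finally show ?thesis by (simp add: sum_distrib_left)
qed

lemma finite_placed_copies: "finite (placed_copies G)"
  unfolding placed_copies_def
  by (intro finite_SigmaI finite_subsets_such_that finite_copies_on)
     (auto intro: finite_subset[OF _ finite_atLeastAtMost])

lemma sum_placed_copies_const:
  assumes "simple_graph G"
  shows "(\<Sum>i\<in>placed_copies G. c) = real (n choose nv G) * rho G * (c :: real)"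
  using sum_copies_const[OF assms order_refl, of "\<lambda>_. c"]
  by (simp add: placed_copies_def n_subsets mult.commute mult.left_commute)

lemma placed_copy_pairs:
  assumes "simple_graph G" "i \<in> placed_copies G"
  shows "edges (snd i) \<subseteq> all_pairs (fst i)" "fst i \<subseteq> {1..n}" "edges (snd i) \<subseteq> all_pairs {1..n}"
proof -
  have i: "fst i \<subseteq> {1..n}" "card (fst i) = nv G" "snd i \<in> copies_on G (fst i)"
    using assms(2) by (auto simp: placed_copies_def)
  then have "finite (fst i)" using finite_subset by blast
  then show "edges (snd i) \<subseteq> all_pairs (fst i)" using copies_onD(2)[OF assms(1)] i by blast
  with i show "fst i \<subseteq> {1..n}" "edges (snd i) \<subseteq> all_pairs {1..n}" by (auto simp: all_pairs_def)
qed

lemma num_copies_eq_count: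
  assumes "simple_graph G" "\<omega> \<in> space M"
  shows "num_copies G n (K \<omega>) = (\<Sum>i\<in>placed_copies G. of_bool (\<omega> \<in> contains (edges (snd i))))"
proof -
  have "(\<Sum>i\<in>placed_copies G. of_bool (\<omega> \<in> contains (edges (snd i))) :: nat)
      = (\<Sum>S | S \<subseteq> {1..n} \<and> card S = nv G. \<Sum>G'\<in>copies_on G S. of_bool (\<omega> \<in> contains (edges G')))"
    unfolding placed_copies_def using finite_subsets_such_that
    by (subst sum.Sigma) (auto intro: finite_copies_on finite_subset[OF _ finite_atLeastAtMost] simp: split_beta)
  then show ?thesis using assms(2) by (simp add: num_copies_def contains_def)
qed

lemma contains_indep_of_far_copies:
  assumes G: "simple_graph G" and i: "i \<in> placed_copies G" and J: "J \<subseteq> placed_copies G - meeting G i"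
  shows "prob (contains (edges (snd i)) \<inter> (space M \<inter> (\<Inter>j\<in>J. contains (edges (snd j)))))
     = prob (contains (edges (snd i))) * prob (space M \<inter> (\<Inter>j\<in>J. contains (edges (snd j))))"
proof -
  let ?F = "\<Union>j\<in>J. edges (snd j)"
  have far: "space M \<inter> (\<Inter>j\<in>J. contains (edges (snd j))) = contains ?F"
    by (auto simp: contains_def)
  moreover have "contains (edges (snd i)) \<inter> contains ?F = contains (edges (snd i) \<union> ?F)"
    by (auto simp: contains_def)
  moreover have "prob (contains (edges (snd i) \<union> ?F)) = prob (contains (edges (snd i))) * prob (contains ?F)"
  proof (rule prob_contains_disjoint)
    show "edges (snd i) \<subseteq> all_pairs (fst i)" "fst i \<subseteq> {1..n}" using placed_copy_pairs[OF G i] by auto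
    show "?F \<subseteq> all_pairs ({1..n} - fst i)"
    proof (rule UN_least)
      fix j assume j: "j \<in> J"
      then have "j \<in> placed_copies G" "j \<notin> meeting G i" using J by blast+
      then have "fst i \<inter> fst j = {}" "j \<in> placed_copies G"
        by (cases j; auto simp: placed_copies_def meeting_def)+
      then show "edges (snd j) \<subseteq> all_pairs ({1..n} - fst i)"
        using placed_copy_pairs[OF G, of j] by (auto simp: all_pairs_def)
    qed
  qed auto
  ultimately show ?thesis by simp
qed

text \<open>The products of the means and the pairs with one common vertex contribute the same bound,
  whence the factor 2 in the first summand.\<close>
lemma local_dependence_term_le:
  assumes G: "simple_graph G" "verts G = {1..nv G}" "edges G \<noteq> {}"
    and i: "i \<in> placed_copies G" and pos: "0 < graphon_sup h"
  defines "p \<equiv> \<lambda>j. contains (edges (snd j))"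
  shows "(\<Sum>j\<in>meeting G i. prob (p i) * prob (p j)) + (\<Sum>j\<in>meeting G i - {i}. prob (p i \<inter> p j))
    \<le> mu h G * (rho G *
        (2 * (real (nv G) ^ 2 / fact (nv G)) * real n ^ (nv G - 1) * graphon_sup h ^ ne G
         + graphon_sup h
         + (\<Sum>s = 2..nv G - 1. real (nv G choose s) *
              (real n ^ (nv G - s) * graphon_sup h powr kappa G s / fact (nv G - s)))))"
proof -
  let ?x = "graphon_sup h" and ?m = "mu h G"
  let ?\<T> = "{T. T \<subseteq> {1..n} \<and> card T = nv G \<and> fst i \<inter> T \<noteq> {}}"
  let ?D = "(real (nv G) ^ 2 / fact (nv G)) * real n ^ (nv G - 1)"
  let ?R = "\<Sum>s = 2..nv G - 1. real (nv G choose s) *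
              (real n ^ (nv G - s) * ?x powr kappa G s / fact (nv G - s))"
  have S: "fst i \<subseteq> {1..n}" "card (fst i) = nv G" "snd i \<in> copies_on G (fst i)"
    using i by (auto simp: placed_copies_def)
  obtain e where e: "e \<in> edges G" using G(3) by blast
  then have eV: "e \<subseteq> verts G" "card e = 2" using G(1) by (auto simp: simple_graph_def all_pairs_def)
  then have v2: "2 \<le> nv G" using card_mono[of "verts G" e] simple_graph_finite[OF G(1)] by simp
  then have V: "verts G \<noteq> {}" by auto
  have pm: "prob (p j) = ?m" if "j \<in> placed_copies G" for j
    unfolding p_def using that by (intro prob_contains_copy[OF G(1,2) V, of "fst j"]) (auto simp: placed_copies_def)
  have m0: "0 \<le> ?m" using pm[OF i, symmetric] by simp
  have r0: "0 \<le> rho G" by (simp add: rho_def)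
  have sub: "meeting G i \<subseteq> placed_copies G" by (auto simp: meeting_def placed_copies_def)
  have fin: "finite (meeting G i)" using sub finite_placed_copies by (rule finite_subset)
  have b0: "0 \<le> overlap_bound G ?x s" for s using pos by (simp add: overlap_bound_def)
  have "(\<Sum>j\<in>meeting G i. prob (p i) * prob (p j)) = (\<Sum>j\<in>meeting G i. ?m * ?m)"
    using pm i sub by (intro sum.cong) auto
  also have "\<dots> = rho G * (real (card ?\<T>) * (?m * ?m))"
    unfolding meeting_def using sum_copies_const[OF G(1), of ?\<T> "\<lambda>_. ?m * ?m"] by auto
  also have "\<dots> \<le> rho G * (?D * (?m * ?x ^ ne G))"
    using r0 m0 card_subsets_meeting_le[OF S(1,2)] mu_le[OF G(1,2) V S]
    by (intro mult_left_mono mult_mono) auto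
  finally have 1: "(\<Sum>j\<in>meeting G i. prob (p i) * prob (p j)) \<le> ?m * (rho G * (?D * ?x ^ ne G))"
    by (simp add: mult.commute mult.left_commute)
  have "(\<Sum>j\<in>meeting G i - {i}. prob (p i \<inter> p j))
      \<le> (\<Sum>j\<in>meeting G i - {i}. ?m * overlap_bound G ?x (card (fst i \<inter> fst j)))"
  proof (rule sum_mono)
    fix j assume j: "j \<in> meeting G i - {i}"
    show "prob (p i \<inter> p j) \<le> ?m * overlap_bound G ?x (card (fst i \<inter> fst j))"
      unfolding p_def
      by (rule prob_two_copies_le[OF G S _ _ _ _ _ pos]) (use j in \<open>auto simp: meeting_def\<close>)
  qed
  also have "\<dots> \<le> (\<Sum>j\<in>meeting G i. ?m * overlap_bound G ?x (card (fst i \<inter> fst j)))"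
    using fin m0 b0 by (intro sum_mono2) auto
  also have "\<dots> = rho G * (\<Sum>T\<in>?\<T>. ?m * overlap_bound G ?x (card (fst i \<inter> T)))"
    unfolding meeting_def by (rule sum_copies_const[OF G(1)]) auto
  also have "\<dots> = rho G * (?m * (\<Sum>T\<in>?\<T>. overlap_bound G ?x (card (fst i \<inter> T))))"
    by (simp add: sum_distrib_left)
  also have "\<dots> \<le> rho G * (?m * (?D * ?x ^ ne G + ?x + ?R))"
    using r0 m0 pos by (intro mult_left_mono sum_overlap_bound_le[OF S(1,2) v2]) auto
  finally have 2: "(\<Sum>j\<in>meeting G i - {i}. prob (p i \<inter> p j)) \<le> rho G * (?m * (?D * ?x ^ ne G + ?x + ?R))" .
  show ?thesis using add_mono[OF 1 2] by (simp add: algebra_simps)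
qed

end

theorem corollary4p1:
  fixes h :: "real \<Rightarrow> real \<Rightarrow> real" and G :: "nat graph" and n :: nat
    and M :: "'w measure" and U :: "nat \<Rightarrow> 'w \<Rightarrow> real" and K :: "'w \<Rightarrow> nat graph"
    and W :: "'w \<Rightarrow> nat" and lam h_star :: real
  assumes h: "graphon h"
    and K: "graphon_random_graph M n h U K"
    and G: "simple_graph G" "verts G = {1..nv G}"
    and balanced: "strictly_balanced G"
    and ne: "ne G > 1"
    and no_isol: "no_isolated G"
    and W: "W = (\<lambda>\<omega>. num_copies G n (K \<omega>))"
    and lam: "lam = prob_space.expectation M (\<lambda>\<omega>. real (W \<omega>))"
    and h_star: "h_star = graphon_sup h"
  shows "lam = real (n choose nv G) * rho G * mu h G \<and>
    d_TV (law M W) (measure_pmf (Po lam)) \<le>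
      2 * (1 - exp (- lam)) * rho G *
        (2 * (real (nv G) ^ 2 / fact (nv G)) * real n ^ (nv G - 1) * h_star ^ ne G
         + h_star
         + (\<Sum>s = 2..nv G - 1.
              real (nv G choose s) * (real n ^ (nv G - s) * h_star powr kappa G s / fact (nv G - s))))"
proof -
  have "prob_space M" using K by (simp add: graphon_random_graph_def)
  then interpret gg: graphon_graph M n h U K
    using h K by (simp add: graphon_graph_def graphon_graph_axioms_def)
  define I where "I = gg.placed_copies G"
  define A where "A i = gg.contains (edges (snd i))" for i :: "nat set \<times> nat graph"
  let ?C = "2 * (real (nv G) ^ 2 / fact (nv G)) * real n ^ (nv G - 1) * h_star ^ ne G
         + h_star
         + (\<Sum>s = 2..nv G - 1.
              real (nv G choose s) * (real n ^ (nv G - s) * h_star powr kappa G s / fact (nv G - s)))"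
  have E: "edges G \<noteq> {}" using ne by auto
  then have V: "verts G \<noteq> {}" using G by (auto simp: simple_graph_def all_pairs_def)
  have x0: "0 \<le> h_star" using gg.graphon_sup_bounds h_star by simp
  have C0: "0 \<le> ?C" using x0 by (intro add_nonneg_nonneg sum_nonneg mult_nonneg_nonneg) auto
  have r0: "0 \<le> rho G" by (simp add: rho_def)
  have ev: "A i \<in> gg.events" if "i \<in> I" for i
    unfolding A_def using that G(1) by (intro gg.contains_events gg.placed_copy_pairs) (auto simp: I_def)
  have W_count: "W \<omega> = (\<Sum>i\<in>I. of_bool (\<omega> \<in> A i))" if "\<omega> \<in> space M" for \<omega>
    unfolding W I_def A_def using G(1) that by (rule gg.num_copies_eq_count)
  have pm: "gg.prob (A i) = mu h G" if "i \<in> I" for i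
    unfolding A_def using that by (intro gg.prob_contains_copy[OF G V, of "fst i"])
      (auto simp: I_def gg.placed_copies_def)
  have "lam = gg.expectation (\<lambda>\<omega>. real (\<Sum>i\<in>I. of_bool (\<omega> \<in> A i)))"
    unfolding lam by (intro Bochner_Integration.integral_cong refl) (simp only: W_count)
  also have "\<dots> = (\<Sum>i\<in>I. gg.prob (A i))" by (rule gg.expectation_count) (rule ev)
  finally have lam_sum: "lam = (\<Sum>i\<in>I. gg.prob (A i))" .
  also have "\<dots> = (\<Sum>i\<in>I. mu h G)" using pm by (rule sum.cong[OF refl])
  also have "\<dots> = real (n choose nv G) * rho G * mu h G"
    unfolding I_def by (rule gg.sum_placed_copies_const[OF G(1)])
  finally have lam_eq: "lam = real (n choose nv G) * rho G * mu h G" .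
  have law_W: "law M W = law M (\<lambda>\<omega>. \<Sum>i\<in>I. of_bool (\<omega> \<in> A i))"
    unfolding law_def by (intro distr_cong refl) (rule W_count)
  define b where "b = (\<Sum>i\<in>I. (\<Sum>j\<in>gg.meeting G i. gg.prob (A i) * gg.prob (A j))
      + (\<Sum>j\<in>gg.meeting G i - {i}. gg.prob (A i \<inter> A j)))"
  have stein: "\<bar>measure (law M W) B - measure_pmf.prob (Po lam) B\<bar> \<le> (1 - exp (- lam)) / lam * b" for B
    unfolding law_W lam_sum b_def
  proof (rule gg.poisson_local_dependence)
    show "finite I" unfolding I_def by (rule gg.finite_placed_copies)
    show "A i \<in> gg.events" if "i \<in> I" for i using ev[OF that] .
    show "i \<in> gg.meeting G i \<and> gg.meeting G i \<subseteq> I" if "i \<in> I" for i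
      using that V simple_graph_finite[OF G(1)]
      by (auto simp: I_def gg.meeting_def gg.placed_copies_def)
    show "gg.prob (A i \<inter> (space M \<inter> (\<Inter>j\<in>J. A j))) = gg.prob (A i) * gg.prob (space M \<inter> (\<Inter>j\<in>J. A j))"
      if "i \<in> I" "J \<subseteq> I - gg.meeting G i" for i J
      using that unfolding A_def I_def by (rule gg.contains_indep_of_far_copies[OF G(1)])
  qed
  have "(1 - exp (- lam)) / lam * b \<le> 2 * (1 - exp (- lam)) * rho G * ?C"
  \<comment> \<open>If the mean vanishes, both sides are \<open>0\<close>. Otherwise \<open>h_star\<close> is positive, as is needed to
    compare its natural and real powers.\<close>
  proof (cases "lam = 0")
    case False
    have lam_pos: "0 < lam" using False by (simp add: lam_sum sum_nonneg less_le)
    then have "I \<noteq> {}" unfolding lam_sum by auto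
    then obtain i where i: "i \<in> I" by blast
    have "mu h G \<le> h_star ^ ne G"
      unfolding h_star using i by (intro gg.mu_le[OF G V, of "fst i" "snd i"]) (auto simp: I_def gg.placed_copies_def)
    moreover have "0 < mu h G"
      using False pm[OF i, symmetric] by (auto simp: lam_eq less_le)
    ultimately have "h_star \<noteq> 0" using ne by (auto simp: zero_power)
    then have pos: "0 < graphon_sup h" using x0 h_star by simp
    have "b \<le> (\<Sum>i\<in>I. mu h G * (rho G * ?C))"
      unfolding b_def A_def h_star using pos G E
      by (intro sum_mono gg.local_dependence_term_le) (auto simp: I_def)
    also have "\<dots> = lam * (rho G * ?C)"
      unfolding I_def gg.sum_placed_copies_const[OF G(1)] lam_eq by (simp only: mult.assoc)
    finally have "(1 - exp (- lam)) / lam * b \<le> (1 - exp (- lam)) / lam * (lam * (rho G * ?C))"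
      using lam_pos by (intro mult_left_mono) auto
    also have "\<dots> = 1 * ((1 - exp (- lam)) * (rho G * ?C))" using lam_pos by simp
    also have "\<dots> \<le> 2 * ((1 - exp (- lam)) * (rho G * ?C))"
      using lam_pos r0 C0 by (intro mult_right_mono mult_nonneg_nonneg) auto
    finally show ?thesis by (simp only: mult.assoc)
  qed simp
  then have "d_TV (law M W) (measure_pmf (Po lam)) \<le> 2 * (1 - exp (- lam)) * rho G * ?C"
    unfolding d_TV_def using stein by (intro cSUP_least) (auto intro: order_trans)
  with lam_eq show ?thesis by blast
qed

end
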